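(* Let $x,y$ be two abstract vector variables and $Y=\{y\}$. For every $k\ge0$, with empty products interpreted as $1$, the determinant $D^{\{y\}}_k=\det\mathcal K^{\{y\}}_k$ is $$D^{\{y\}}_k=\bigl([m]_q+Q[k]_q\bigr)\,C^{\mathrm R}_k\prod_{a=0}^{k/2-1}[2a+2]_q\,A_{k,a}\prod_{a=0}^{k/2-1}[2a+2]_q\,B^{\mathrm R}_{k,a}\qquad(k\text{ even}),$$ $$D^{\{y\}}_k=[k+1]_q\,C^{\mathrm R}_k\prod_{a=0}^{(k-1)/2}[2a+2]_q\,A_{k,a}\prod_{a=0}^{(k-3)/2}[2a+2]_q\,B^{\mathrm R}_{k,a}\qquad(k\text{ odd}),$$ where $$A_{k,a}=[m]_q+Q\bigl([2a]_q+2q^{2a}[k-2a]_q\bigr)\quad\bigl(0\le a\le\lfloor\tfrac{k-1}2\rfloor\bigr),$$ $$B^{\mathrm R}_{k,a}=[m-1]_q+Qq^{-1}\bigl([k]_q+q^{2a+2}[k-1-2a]_q\bigr)\quad\bigl(0\le a\le\lfloor\tfrac{k-2}2\rfloor\bigr),$$ $$C^{\mathrm R}_k=[m-1]_q+[k+1]_q+Qq^{-1}[k]_q .$$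
   Context: **Radial algebra.** $R(\{x,y\})$ is the associative unital $\mathbb R$-algebra generated by $x,y$ subject to $[\{u,v\},w]=0$ for all $u,v,w\in\{x,y\}$, where $\{a,b\}=ab+ba$, $[a,b]=ab-ba$. Put $w=x\wedge y=\frac12(xy-yx)$. **Coefficients.** $q,Q$ are algebraically independent indeterminates, $\mathbb B=\mathbb R[q,q^{-1},Q,(1-q)^{-1}]$, $R_{\mathbb B}(\{x,y\})=\mathbb B\otimes_{\mathbb R}R(\{x,y\})$. For integers $n,a$: $[n]_q=\frac{1-q^n}{1-q}$, $q^{m+a}:=Qq^a$, $[m+a]_q:=\frac{1-Qq^a}{1-q}$ ($m$ is only a formal symbol). **Scalars.** $r=x^2$, $s=\{x,y\}$, $t=y^2$ are central, and $R_{\mathbb B}(\{x,y\})$ is free over the polynomial algebra $\mathbb B[r,s,t]$ with basis $1,y,x,w$ (known). **Derivative.** For a scalar variable $u$ and parameter $P$: $\delta^{(u)}_Pf=\frac{f(u)-f(Pu)}{(1-P)u}$, $T^{(u)}_Pf(u)=f(Pu)$. For $f\in\mathbb B[r,s,t]$ put $\partial^{\mathrm{sc}}f=(1+q)\,x\,\delta^{(r)}_{q^2}f+2\,y\,T^{(r)}_{q^2}\delta^{(s)}_qf$. The right $q$-vector derivative $\partial^{\{y\},\mathrm R}_{x,q}$ is the $\mathbb B$-linear operator with $$f\mapsto\partial^{\mathrm{sc}}f,\quad yf\mapsto y\,\partial^{\mathrm{sc}}f,\quad xf\mapsto[m]_qf+Q\,x\,\partial^{\mathrm{sc}}f,\quad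 wf\mapsto-[m-1]_q\,yf+Qq^{-1}\,w\,\partial^{\mathrm{sc}}f .$$ **Blocks.** The $x$-degree is $\deg_xr=2$, $\deg_xs=1$, $\deg_xt=0$, $\deg_x1=\deg_xy=0$, $\deg_xx=\deg_xw=1$. $H^{\{y\}}_k$ is the degree-$k$ component, a finite free module over $\mathbb T_{\{y\}}=\mathbb B[t]$ with basis $r^as^b,\ yr^as^b$ ($2a+b=k$) and $xr^as^b,\ wr^as^b$ ($1+2a+b=k$). With $R_xF=Fx$, $\mathcal K^{\{y\}}_k:=\partial^{\{y\},\mathrm R}_{x,q}R_x|_{H^{\{y\}}_k}:H^{\{y\}}_k\to H^{\{y\}}_k$ is $\mathbb B[t]$-linear. *)

theory Defs
  imports
    "HOL-Computational_Algebra.Fraction_Field"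
    "HOL-Computational_Algebra.Polynomial"
    "HOL-Library.Poly_Mapping"
    "Jordan_Normal_Form.Determinant"
    Complex_Main
begin

section \<open>The coefficient ring\<close>

text \<open>
  The field \<open>\<real>(q, Q)\<close> is the fraction field of \<open>\<real>[q][Q]\<close>, so that \<open>q\<close> and \<open>Q\<close> are algebraically
  independent. The coefficient ring is its subring \<open>\<real>[q, 1/q, Q, 1/(1-q)]\<close>.
\<close>

type_synonym ratfun = "real poly poly fract"

definition real_rf :: "real \<Rightarrow> ratfun" where
  "real_rf c = Fract [:[:c:]:] 1"

definition q_rf :: ratfun where
  "q_rf = Fract [:[:0, 1:]:] 1"

definition Q_rf :: ratfun where
  "Q_rf = Fract [:0, 1:] 1"

inductive_set coeff_set :: "ratfun set" where
  real: "real_rf c \<in> coeff_set"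
| q: "q_rf \<in> coeff_set"
| q_inverse: "inverse q_rf \<in> coeff_set"
| Q: "Q_rf \<in> coeff_set"
| one_minus_q_inverse: "inverse (1 - q_rf) \<in> coeff_set"
| add: "a \<in> coeff_set \<Longrightarrow> b \<in> coeff_set \<Longrightarrow> a + b \<in> coeff_set"
| mult: "a \<in> coeff_set \<Longrightarrow> b \<in> coeff_set \<Longrightarrow> a * b \<in> coeff_set"

lemma zero_in_coeff_set: "0 \<in> coeff_set"
  using coeff_set.real[of 0] by (simp add: real_rf_def Zero_fract_def)

lemma one_in_coeff_set: "1 \<in> coeff_set"
  using coeff_set.real[of 1] by (simp add: real_rf_def One_fract_def one_pCons)

lemma uminus_in_coeff_set:
  assumes "a \<in> coeff_set" shows "- a \<in> coeff_set"
proof -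
  have "real_rf (- 1) = - 1"
    by (simp add: real_rf_def One_fract_def one_pCons)
  then have "- 1 \<in> coeff_set"
    using coeff_set.real[of "- 1"] by simp
  from coeff_set.mult[OF this assms] show ?thesis by simp
qed

lemma minus_in_coeff_set:
  "a \<in> coeff_set \<Longrightarrow> b \<in> coeff_set \<Longrightarrow> a - b \<in> coeff_set"
  using coeff_set.add[OF _ uminus_in_coeff_set, of a b] by simp

lemma power_in_coeff_set: "a \<in> coeff_set \<Longrightarrow> a ^ n \<in> coeff_set"
  by (induction n) (auto intro: one_in_coeff_set coeff_set.mult)

lemma q_powi_in_coeff_set: "q_rf powi n \<in> coeff_set"
  by (auto simp: power_int_def intro: power_in_coeff_set coeff_set.intros)

typedef BB = coeff_set
  using zero_in_coeff_set by blast

setup_lifting type_definition_BB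

instantiation BB :: idom
begin
lift_definition zero_BB :: BB is 0 by (rule zero_in_coeff_set)
lift_definition one_BB :: BB is 1 by (rule one_in_coeff_set)
lift_definition plus_BB :: "BB \<Rightarrow> BB \<Rightarrow> BB" is "(+)" by (rule coeff_set.add)
lift_definition times_BB :: "BB \<Rightarrow> BB \<Rightarrow> BB" is "(*)" by (rule coeff_set.mult)
lift_definition uminus_BB :: "BB \<Rightarrow> BB" is uminus by (rule uminus_in_coeff_set)
lift_definition minus_BB :: "BB \<Rightarrow> BB \<Rightarrow> BB" is minus by (rule minus_in_coeff_set)
instance
  by standard (transfer; simp add: algebra_simps)+
end

lift_definition real_BB :: "real \<Rightarrow> BB" is real_rf by (rule coeff_set.real)

lift_definition Q_BB :: BB is Q_rf by (rule coeff_set.Q)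

lift_definition qpow :: "int \<Rightarrow> BB" is "\<lambda>n. q_rf powi n"
  by (rule q_powi_in_coeff_set)

text \<open>\<open>qnum n\<close> is \<open>[n]\<^sub>q\<close>, and \<open>qnum_m a\<close> is \<open>[m + a]\<^sub>q\<close>, where \<open>m\<close> is a formal symbol with \<open>q\<^sup>m = Q\<close>.\<close>

lift_definition qnum :: "int \<Rightarrow> BB" is "\<lambda>n. (1 - q_rf powi n) / (1 - q_rf)"
  unfolding divide_inverse
  by (intro coeff_set.mult minus_in_coeff_set one_in_coeff_set q_powi_in_coeff_set
      coeff_set.one_minus_q_inverse)

lift_definition qnum_m :: "int \<Rightarrow> BB" is "\<lambda>a. (1 - Q_rf * q_rf powi a) / (1 - q_rf)"
  unfolding divide_inverse
  by (intro coeff_set.mult minus_in_coeff_set one_in_coeff_set q_powi_in_coeff_set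
      coeff_set.one_minus_q_inverse coeff_set.Q)


section \<open>The radial algebra\<close>

text \<open>
  The free algebra on two generators over \<open>'a\<close> is the monoid algebra of the free monoid of words.
  Its quotient by the radial relations is defined over an arbitrary commutative ring \<open>'a\<close>: the
  instance \<open>'a = real\<close> is the radial algebra \<open>R({x, y})\<close>, and, since presentations are stable
  under base change, \<open>'a = BB\<close> is \<open>R\<^sub>\<bbbB>({x, y}) = \<bbbB> \<otimes> R({x, y})\<close>.
\<close>

datatype gen = Gx | Gy

datatype wrd = Wrd (letters: "gen list")

instantiation wrd :: monoid_add
begin
definition zero_wrd :: wrd where "0 = Wrd []"
definition plus_wrd :: "wrd \<Rightarrow> wrd \<Rightarrow> wrd" where "u + v = Wrd (letters u @ letters v)"
instance
  by standard (auto simp: zero_wrd_def plus_wrd_def)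
end

type_synonym 'a free_alg = "wrd \<Rightarrow>\<^sub>0 'a"

definition free_gen :: "gen \<Rightarrow> 'a::comm_ring_1 free_alg" where
  "free_gen g = Poly_Mapping.single (Wrd [g]) 1"

definition anticommutator :: "'a::ring \<Rightarrow> 'a \<Rightarrow> 'a" where
  "anticommutator a b = a * b + b * a"

definition commutator :: "'a::ring \<Rightarrow> 'a \<Rightarrow> 'a" where
  "commutator a b = a * b - b * a"

inductive_set radial_ideal :: "'a::comm_ring_1 free_alg set" where
  zero: "0 \<in> radial_ideal"
| relation: "commutator (anticommutator (free_gen u) (free_gen v)) (free_gen w) \<in> radial_ideal"
| add: "a \<in> radial_ideal \<Longrightarrow> b \<in> radial_ideal \<Longrightarrow> a + b \<in> radial_ideal"
| mult_left: "a \<in> radial_ideal \<Longrightarrow> c * a \<in> radial_ideal"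
| mult_right: "a \<in> radial_ideal \<Longrightarrow> a * c \<in> radial_ideal"

definition radial_rel :: "'a::comm_ring_1 free_alg \<Rightarrow> 'a free_alg \<Rightarrow> bool" where
  "radial_rel a b \<longleftrightarrow> a - b \<in> radial_ideal"

lemma uminus_in_radial_ideal: "a \<in> radial_ideal \<Longrightarrow> - a \<in> radial_ideal"
  using radial_ideal.mult_left[of a "- 1"] by simp

lemma equivp_radial_rel: "equivp radial_rel"
proof (rule equivpI)
  show "reflp radial_rel"
    by (auto simp: reflp_def radial_rel_def radial_ideal.zero)
  show "symp radial_rel"
    unfolding symp_def radial_rel_def
    by (metis minus_diff_eq uminus_in_radial_ideal)
  show "transp radial_rel"
    unfolding transp_def radial_rel_def
    by (metis diff_add_cancel add_diff_eq radial_ideal.add)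
qed

lemma lookup_times_zero_wrd:
  fixes f g :: "'a::comm_ring_1 free_alg"
  shows "Poly_Mapping.lookup (f * g) 0 = Poly_Mapping.lookup f 0 * Poly_Mapping.lookup g 0"
proof -
  let ?f = "Poly_Mapping.lookup f" and ?g = "Poly_Mapping.lookup g"
  have sum_zero: "(0 = k + l) \<longleftrightarrow> k = 0 \<and> l = 0" for k l :: wrd
    by (cases k; cases l) (auto simp: zero_wrd_def plus_wrd_def)
  have inner: "(\<Sum>l. ?g l when (0::wrd) = k + l) = (?g 0 when k = 0)" for k
  proof -
    have "(\<lambda>l. ?g l when (0::wrd) = k + l) = (\<lambda>l. (?g 0 when k = 0) when l = 0)"
      by (auto simp: sum_zero when_def fun_eq_iff)
    then show ?thesis by (simp only: Sum_any_when_equal)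
  qed
  have "(\<lambda>k. ?f k * (?g 0 when k = 0)) = (\<lambda>k. (?f 0 * ?g 0) when k = 0)"
    by (auto simp: when_def fun_eq_iff)
  then show ?thesis
    by (simp only: lookup_mult inner Sum_any_when_equal)
qed

lemma radial_ideal_lookup_zero: "a \<in> radial_ideal \<Longrightarrow> Poly_Mapping.lookup a 0 = 0"
  by (induction rule: radial_ideal.induct)
    (simp_all add: lookup_times_zero_wrd lookup_add lookup_minus commutator_def anticommutator_def
      algebra_simps)

quotient_type (overloaded) 'a radial = "'a::comm_ring_1 free_alg" / radial_rel
  by (rule equivp_radial_rel)

instantiation radial :: (comm_ring_1) ring_1
begin
lift_definition zero_radial :: "'a radial" is 0 .
lift_definition one_radial :: "'a radial" is 1 .
lift_definition plus_radial :: "'a radial \<Rightarrow> 'a radial \<Rightarrow> 'a radial" is "(+)"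
  unfolding radial_rel_def by (metis add_diff_add radial_ideal.add)
lift_definition uminus_radial :: "'a radial \<Rightarrow> 'a radial" is uminus
  unfolding radial_rel_def by (metis minus_diff_minus uminus_in_radial_ideal)
lift_definition minus_radial :: "'a radial \<Rightarrow> 'a radial \<Rightarrow> 'a radial" is minus
proof -
  fix a b c d :: "'a free_alg"
  assume "radial_rel a b" "radial_rel c d"
  then have "(a - b) + - (c - d) \<in> radial_ideal"
    unfolding radial_rel_def by (intro radial_ideal.add uminus_in_radial_ideal)
  then show "radial_rel (a - c) (b - d)"
    unfolding radial_rel_def by (simp add: algebra_simps)
qed
lift_definition times_radial :: "'a radial \<Rightarrow> 'a radial \<Rightarrow> 'a radial" is "(*)"
proof -
  fix a b c d :: "'a free_alg"
  assume "radial_rel a b" "radial_rel c d"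
  then have "(a - b) * c + b * (c - d) \<in> radial_ideal"
    unfolding radial_rel_def
    by (intro radial_ideal.add radial_ideal.mult_left radial_ideal.mult_right)
  then show "radial_rel (a * c) (b * d)"
    unfolding radial_rel_def by (simp add: algebra_simps)
qed
instance
proof
  show "(0 :: 'a radial) \<noteq> 1"
  proof transfer
    show "\<not> radial_rel (0 :: 'a free_alg) 1"
    proof
      assume "radial_rel (0 :: 'a free_alg) 1"
      then have "Poly_Mapping.lookup (0 - 1 :: 'a free_alg) 0 = 0"
        unfolding radial_rel_def by (rule radial_ideal_lookup_zero)
      then show False by (simp add: lookup_minus lookup_one)
    qed
  qed
qed (transfer; simp add: algebra_simps radial_rel_def radial_ideal.zero)+
end

lift_definition const_radial :: "'a::comm_ring_1 \<Rightarrow> 'a radial" is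
  "\<lambda>c. Poly_Mapping.single 0 c" .

lift_definition gen_radial :: "gen \<Rightarrow> 'a::comm_ring_1 radial" is free_gen .

type_synonym RB = "BB radial"

definition xv :: RB where "xv = gen_radial Gx"

definition yv :: RB where "yv = gen_radial Gy"

definition wv :: RB where "wv = const_radial (real_BB (1 / 2)) * commutator xv yv"


section \<open>Scalars\<close>

text \<open>
  The polynomial ring \<open>\<bbbB>[r, s, t]\<close> is represented as \<open>\<bbbB>[t][s][r]\<close> (\<open>r\<close> is the outermost
  variable). The evaluation maps send \<open>r, s, t\<close> to the central elements \<open>x\<^sup>2\<close>, \<open>{x, y}\<close>, \<open>y\<^sup>2\<close>.
\<close>

type_synonym scalar = "BB poly poly poly"

definition poly_eval_with :: "('a::zero \<Rightarrow> 'b::ring_1) \<Rightarrow> 'b \<Rightarrow> 'a poly \<Rightarrow> 'b" where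
  "poly_eval_with h u p = (\<Sum>i\<le>degree p. h (coeff p i) * u ^ i)"

definition eval_t :: "BB poly \<Rightarrow> RB" where
  "eval_t = poly_eval_with const_radial (yv ^ 2)"

definition eval_scalar :: "scalar \<Rightarrow> RB" where
  "eval_scalar =
     poly_eval_with (poly_eval_with eval_t (anticommutator xv yv)) (xv ^ 2)"

definition const_scalar :: "BB \<Rightarrow> scalar" where "const_scalar c = [:[:[:c:]:]:]"

definition r_var :: scalar where "r_var = [:0, 1:]"

definition s_var :: scalar where "s_var = [:[:0, 1:]:]"

text \<open>\<open>T_r P f\<close> and \<open>T_s P f\<close> replace \<open>r\<close> by \<open>P r\<close> and \<open>s\<close> by \<open>P s\<close>, respectively.\<close>

definition T_r :: "BB \<Rightarrow> scalar \<Rightarrow> scalar" where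
  "T_r P f = pcompose f [:0, [:[:P:]:]:]"

definition T_s :: "BB \<Rightarrow> scalar \<Rightarrow> scalar" where
  "T_s P f = map_poly (\<lambda>c. pcompose c [:0, [:P:]:]) f"

text \<open>
  The quotient \<open>(f(u) - f(P u)) / ((1 - P) u)\<close> is the unique \<open>g\<close> with \<open>(1 - P) u g = f(u) - f(P u)\<close>.
  For \<open>P = q\<close> and \<open>P = q\<^sup>2\<close> it exists over \<open>\<bbbB>\<close>, although \<open>1 - q\<^sup>2\<close> is not a unit of \<open>\<bbbB>\<close>.
\<close>

definition delta_r :: "BB \<Rightarrow> scalar \<Rightarrow> scalar" where
  "delta_r P f = (THE g. const_scalar (1 - P) * r_var * g = f - T_r P f)"

definition delta_s :: "BB \<Rightarrow> scalar \<Rightarrow> scalar" where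
  "delta_s P f = (THE g. const_scalar (1 - P) * s_var * g = f - T_s P f)"


section \<open>The right \<open>q\<close>-vector derivative\<close>

definition d_sc :: "scalar \<Rightarrow> RB" where
  "d_sc f =
     const_radial (1 + qpow 1) * xv * eval_scalar (delta_r (qpow 2) f)
     + 2 * yv * eval_scalar (T_r (qpow 2) (delta_s (qpow 1) f))"

definition is_right_q_derivative :: "(RB \<Rightarrow> RB) \<Rightarrow> bool" where
  "is_right_q_derivative D \<longleftrightarrow>
     (\<forall>F G. D (F + G) = D F + D G) \<and>
     (\<forall>c F. D (const_radial c * F) = const_radial c * D F) \<and>
     (\<forall>f. D (eval_scalar f) = d_sc f) \<and>
     (\<forall>f. D (yv * eval_scalar f) = yv * d_sc f) \<and>
     (\<forall>f. D (xv * eval_scalar f) =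
        const_radial (qnum_m 0) * eval_scalar f + const_radial Q_BB * xv * d_sc f) \<and>
     (\<forall>f. D (wv * eval_scalar f) =
        - const_radial (qnum_m (- 1)) * yv * eval_scalar f
        + const_radial (Q_BB * qpow (- 1)) * wv * d_sc f)"

text \<open>
  There is exactly one such operator because the algebra is free over \<open>\<bbbB>[r, s, t]\<close>
  with basis \<open>1, y, x, w\<close>.
\<close>

definition right_q_derivative :: "RB \<Rightarrow> RB" where
  "right_q_derivative = (THE D. is_right_q_derivative D)"


section \<open>Blocks\<close>

text \<open>\<open>f\<close> times a basis element of \<open>x\<close>-degree \<open>d\<close> is homogeneous of \<open>x\<close>-degree \<open>k\<close>.\<close>

definition homogeneous_scalar :: "nat \<Rightarrow> nat \<Rightarrow> scalar \<Rightarrow> bool" where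
  "homogeneous_scalar d k f \<longleftrightarrow>
     (\<forall>a b. coeff (coeff f a) b \<noteq> 0 \<longrightarrow> d + 2 * a + b = k)"

definition H_block :: "nat \<Rightarrow> RB set" where
  "H_block k =
     {eval_scalar f0 + yv * eval_scalar f1 + xv * eval_scalar f2 + wv * eval_scalar f3
      | f0 f1 f2 f3.
        homogeneous_scalar 0 k f0 \<and> homogeneous_scalar 0 k f1 \<and>
        homogeneous_scalar 1 k f2 \<and> homogeneous_scalar 1 k f3}"

definition K_op :: "RB \<Rightarrow> RB" where
  "K_op F = right_q_derivative (F * xv)"

text \<open>
  Determinant of an endomorphism of a finite free \<open>\<bbbB>[t]\<close>-submodule: the common value of the
  determinants of its matrices in all bases. For \<open>H_block k\<close> one basis consists of \<open>r\<^sup>a s\<^sup>b\<close>,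
  \<open>y r\<^sup>a s\<^sup>b\<close> with \<open>2a + b = k\<close> and \<open>x r\<^sup>a s\<^sup>b\<close>, \<open>w r\<^sup>a s\<^sup>b\<close> with \<open>1 + 2a + b = k\<close>.
\<close>

definition is_basis_over_t :: "RB set \<Rightarrow> RB list \<Rightarrow> bool" where
  "is_basis_over_t H bs \<longleftrightarrow>
     set bs \<subseteq> H \<and>
     (\<forall>F\<in>H. \<exists>!c. c \<in> carrier_vec (length bs) \<and> F = (\<Sum>i<length bs. eval_t (c $ i) * bs ! i))"

definition is_matrix_over_t :: "(RB \<Rightarrow> RB) \<Rightarrow> RB list \<Rightarrow> BB poly mat \<Rightarrow> bool" where
  "is_matrix_over_t L bs M \<longleftrightarrow>
     M \<in> carrier_mat (length bs) (length bs) \<and>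
     (\<forall>j<length bs. L (bs ! j) = (\<Sum>i<length bs. eval_t (M $$ (i, j)) * bs ! i))"

definition det_over_t :: "RB set \<Rightarrow> (RB \<Rightarrow> RB) \<Rightarrow> BB poly" where
  "det_over_t H L =
     (THE d. \<exists>bs M. is_basis_over_t H bs \<and> is_matrix_over_t L bs M \<and> d = det M)"

definition D_det :: "nat \<Rightarrow> BB poly" where
  "D_det k = det_over_t (H_block k) K_op"


section \<open>The factors of the determinant\<close>

definition A_fac :: "nat \<Rightarrow> nat \<Rightarrow> BB" where
  "A_fac k a =
     qnum_m 0 + Q_BB * (qnum (2 * int a) + 2 * qpow (2 * int a) * qnum (int k - 2 * int a))"

definition B_fac :: "nat \<Rightarrow> nat \<Rightarrow> BB" where
  "B_fac k a =
     qnum_m (- 1)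
     + Q_BB * qpow (- 1) * (qnum (int k) + qpow (2 * int a + 2) * qnum (int k - 1 - 2 * int a))"

definition C_fac :: "nat \<Rightarrow> BB" where
  "C_fac k = qnum_m (- 1) + qnum (int k + 1) + Q_BB * qpow (- 1) * qnum (int k)"

end

theory Submission
  imports Defs "HOL-Library.Product_Plus"
begin

text \<open>
  Replacing \<open>w\<close> by \<open>yx = s/2 - w\<close>, the algebra is free over \<open>\<bbbB>[r, s, t]\<close> with basis \<open>1, y, x, yx\<close>.
  Put \<open>u\<^sub>j = \<epsilon>\<^sub>j r\<^sup>a s\<^bsup>k-j\<^esup>\<close> and \<open>v\<^sub>j = \<eta>\<^sub>j r\<^sup>a s\<^bsup>k-j\<^esup>\<close> for \<open>a = \<lfloor>j/2\<rfloor>\<close> and \<open>0 \<le> j \<le> k\<close>, where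
  \<open>(\<epsilon>\<^sub>j, \<eta>\<^sub>j)\<close> is \<open>(1, y)\<close> for even \<open>j\<close> and \<open>(yx, x)\<close> for odd \<open>j\<close>. Since \<open>yx \<cdot> x = r y\<close>, right
  multiplication by \<open>x\<close> has a simple form, and \<open>K\<close> is lower bidiagonal on the \<open>u\<^sub>j\<close>, with diagonal
  \<open>A\<^sub>k\<^sub>,\<^sub>a\<close> for \<open>j = 2a\<close> and \<open>[2a+2]\<close> for \<open>j = 2a+1\<close>. On the \<open>v\<^sub>j\<close> it is tridiagonal; adding
  \<open>-(1 - Q/q)/2\<close> times the column of \<open>v\<^sub>2\<^sub>a\<^sub>+\<^sub>1\<close> to the column of \<open>v\<^sub>2\<^sub>a\<^sub>+\<^sub>2\<close> makes the matrix lower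
  triangular, with pivots \<open>C\<^sub>k\<close>, \<open>[2a+2]\<close> and \<open>B\<^sub>k\<^sub>,\<^sub>a\<close>.
\<close>

section \<open>Arithmetic of the coefficient ring\<close>

lemma q_rf_power: "q_rf ^ n = Fract [:[:0, 1:] ^ n:] 1"
proof (induction n)
  case 0
  then show ?case by (simp add: One_fract_def one_pCons)
next
  case (Suc n)
  then show ?case by (simp add: q_rf_def)
qed

text \<open>Compared by degree in \<open>q\<close>. Applied to \<open>q\<close> and
  \<open>q^2\<close>, this makes \<open>1 - P\<close> nonzero, hence cancellable, in the equations
  that define the difference quotients.\<close>

lemma q_rf_power_neq_1:
  assumes "n > 0"
  shows "q_rf ^ n \<noteq> 1"
proof
  assume "q_rf ^ n = 1"
  then have "[:[:0, 1:] ^ n:] = (1 :: real poly poly)"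
    by (simp add: q_rf_power One_fract_def eq_fract)
  then have "[:0, 1:] ^ n = (1 :: real poly)"
    by (simp add: one_pCons)
  moreover have "degree ([:0, 1:] ^ n :: real poly) = n"
    by (simp add: degree_power_eq)
  ultimately show False using assms by simp
qed

lemma q_rf_nonzero: "q_rf \<noteq> 0"
  by (simp add: q_rf_def Zero_fract_def eq_fract)

lemma q_rf_neq_1: "q_rf \<noteq> 1"
  using q_rf_power_neq_1[of 1] by simp

lemma qpow_0 [simp]: "qpow 0 = 1"
  by transfer simp

lemma qpow_add: "qpow (a + b) = qpow a * qpow b"
  by transfer (simp add: power_int_add q_rf_nonzero)

lemma qpow_power: "qpow a ^ n = qpow (a * int n)"
  by (induction n) (simp_all add: qpow_add[symmetric] algebra_simps)

lemma qpow_neq_1: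
  assumes "n > 0"
  shows "qpow (int n) \<noteq> 1"
  using q_rf_power_neq_1[OF assms] by transfer simp

lemma qnum_0 [simp]: "qnum 0 = 0"
  by transfer simp

lemma qnum_1 [simp]: "qnum 1 = 1"
  using q_rf_neq_1 by transfer simp

lemma qnum_add: "qnum (a + b) = qnum a + qpow a * qnum b"
  using q_rf_neq_1
  by transfer (simp add: power_int_add q_rf_nonzero divide_simps, simp add: algebra_simps)

lemma sum_power_q: "(\<Sum>j<n. qpow 1 ^ j) = qnum (int n)"
proof (induction n)
  case (Suc n)
  have "int (Suc n) = int n + 1" by simp
  then show ?case
    using Suc by (simp only: qnum_add sum.lessThan_Suc) (simp add: qpow_power)
qed simp

text \<open>Absorbs the factor \<open>1 + q\<close> of \<open>d_sc\<close> into the difference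
  quotient of base \<open>q^2\<close> in \<open>r\<close>, so that \<open>d_sc\<close> of a monomial
  involves q-numbers of base \<open>q\<close> only.\<close>

lemma sum_power_q2: "(1 + qpow 1) * (\<Sum>j<n. qpow 2 ^ j) = qnum (2 * int n)"
proof (induction n)
  case (Suc n)
  have "2 * int (Suc n) = 2 * int n + (1 + 1)" by simp
  then have "qnum (2 * int (Suc n)) = qnum (2 * int n) + qpow (2 * int n) * (1 + qpow 1)"
    by (simp only: qnum_add qnum_1) simp
  then show ?case
    using Suc by (simp only: sum.lessThan_Suc distrib_left) (simp add: qpow_power algebra_simps)
qed simp

lemma real_BB_half: "real_BB (1 / 2) + real_BB (1 / 2) = 1"
  by transfer (simp add: real_rf_def One_fract_def one_pCons)

lemma two_times_half: "2 * real_BB (1 / 2) = 1"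
  using real_BB_half by (simp add: algebra_simps)

section \<open>Determinants over commutative rings\<close>

text \<open>Invariance of rank. If \<open>m < n\<close>, zero columns appended to \<open>A\<close>
  and zero rows appended to \<open>B\<close> give square matrices with the same product, and the
  zero row forces \<open>1 = det A' * det B' = 0\<close>. Applied both ways, it shows that two bases
  have equal length.\<close>

lemma mult_eq_one_mat_imp_le:
  fixes A B :: "'a :: comm_ring_1 mat"
  assumes A: "A \<in> carrier_mat n m" and B: "B \<in> carrier_mat m n" and AB: "A * B = 1\<^sub>m n"
  shows "n \<le> m"
proof (rule ccontr)
  assume "\<not> n \<le> m"
  then have mn: "m < n" by simp
  define A' where "A' = mat n n (\<lambda>(i, j). if j < m then A $$ (i, j) else 0)"
  define B' where "B' = mat n n (\<lambda>(i, j). if i < m then B $$ (i, j) else 0)"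
  have A': "A' \<in> carrier_mat n n" and B': "B' \<in> carrier_mat n n"
    by (simp_all add: A'_def B'_def)
  have "A' * B' = A * B"
  proof (rule eq_matI)
    fix i j assume "i < dim_row (A * B)" "j < dim_col (A * B)"
    then have ij: "i < n" "j < n" using A B by auto
    have "(A' * B') $$ (i, j) = (\<Sum>l\<in>{0..<n}. if l < m then A $$ (i, l) * B $$ (l, j) else 0)"
      using ij by (simp add: A'_def B'_def scalar_prod_def) (rule sum.cong, auto)
    also have "\<dots> = (\<Sum>l\<in>{0..<m}. A $$ (i, l) * B $$ (l, j))"
      using mn by (intro sum.mono_neutral_cong_right) auto
    also have "\<dots> = (A * B) $$ (i, j)"
      using ij A B by (auto simp: scalar_prod_def intro!: sum.cong)
    finally show "(A' * B') $$ (i, j) = (A * B) $$ (i, j)" .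
  qed (use A B in \<open>auto simp: A'_def B'_def\<close>)
  then have "det A' * det B' = 1"
    using AB det_mult[OF A' B'] by simp
  moreover have "det B' = 0"
  proof -
    have "B' = mat\<^sub>r n n (\<lambda>i. if i = m then 0\<^sub>v n else row B' i)"
      by (rule eq_matI) (auto simp: B'_def)
    then show ?thesis
      using det_row_0[OF mn, of "row B'"] B' by (metis (no_types, lifting) Pi_I row_carrier_vec atLeastLessThan_iff)
  qed
  ultimately show False by simp
qed

text \<open>\<open>c j\<close> times column \<open>j - 1\<close> is subtracted from column \<open>j\<close>, which leaves a lower triangular matrix.\<close>

lemma det_tridiagonal:
  fixes di lo up c :: "nat \<Rightarrow> 'a :: idom"
  assumes M: "M = mat n n (\<lambda>(i, j). if i = j then di j else if i = Suc j then lo j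
                            else if j = Suc i then up j else 0)"
    and up: "\<And>j. Suc j < n \<Longrightarrow> up (Suc j) = c (Suc j) * di j"
    and up': "\<And>j. Suc j < n \<Longrightarrow> c (Suc j) * up j = 0"
    and "c 0 = 0"
  shows "det M = (\<Prod>j<n. di j - c j * lo (j - 1))"
proof -
  \<comment> \<open>\<open>U\<close> performs the column operations. Column \<open>j - 1\<close>
    enters column \<open>j\<close> in three rows: in row \<open>j - 1\<close> it cancels the
    superdiagonal entry by \<open>up\<close>, in row \<open>j - 2\<close> it contributes nothing by
    \<open>up'\<close>, and in row \<open>j\<close> it changes the pivot.\<close>
  define U where "U = mat n n (\<lambda>(i, j). if i = j then 1 else if j = Suc i then - c j else 0)"
  have carr: "M \<in> carrier_mat n n" "U \<in> carrier_mat n n"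
    by (simp_all add: M U_def)
  have entry: "(M * U) $$ (i, j) = M $$ (i, j) - (if j = 0 then 0 else c j * M $$ (i, j - 1))"
    if ij: "i < n" "j < n" for i j
  proof -
    have "(M * U) $$ (i, j) = (\<Sum>l\<in>{0..<n}. M $$ (i, l) * U $$ (l, j))"
      using ij carr by (auto simp: scalar_prod_def intro!: sum.cong)
    also have "\<dots> = (\<Sum>l\<in>{0..<n}. (if l = j then M $$ (i, l) else 0)
        - (if j \<noteq> 0 \<and> l = j - 1 then c j * M $$ (i, l) else 0))"
      using ij by (intro sum.cong) (auto simp: U_def)
    also have "\<dots> = M $$ (i, j) - (if j = 0 then 0 else c j * M $$ (i, j - 1))"
      using ij by (cases j) (auto simp: sum_subtractf)
    finally show ?thesis .
  qed
  have "det U = 1"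
  proof -
    have "upper_triangular U" by (auto simp: U_def)
    then have "det U = prod_list (diag_mat U)"
      using carr by (intro det_upper_triangular)
    also have "diag_mat U = map (\<lambda>_. 1) [0..<n]"
      by (auto simp: diag_mat_def U_def)
    also have "prod_list \<dots> = 1" by (induction n) auto
    finally show ?thesis .
  qed
  then have "det M = det (M * U)"
    using det_mult[OF carr] by simp
  also have "\<dots> = prod_list (diag_mat (M * U))"
  proof (rule det_lower_triangular)
    fix i j assume ij: "i < j" "j < n"
    then obtain j' where j': "j = Suc j'" by (cases j) auto
    show "(M * U) $$ (i, j) = 0"
      using ij up[of j'] up'[of j'] unfolding j'
      by (subst entry) (auto simp: M)
  qed (use carr in auto)
  also have "diag_mat (M * U) = map (\<lambda>j. di j - c j * lo (j - 1)) [0..<n]"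
  proof -
    \<comment> \<open>For \<open>j = 0\<close> no column is subtracted, while the formula has the
      truncated index \<open>j - 1 = 0\<close>; \<open>c 0 = 0\<close> reconciles the two.\<close>
    have "(M * U) $$ (j, j) = di j - c j * lo (j - 1)" if "j < n" for j
      using that \<open>c 0 = 0\<close> by (subst entry) (auto simp: M)
    then show ?thesis using carr by (auto simp: diag_mat_def)
  qed
  also have "prod_list \<dots> = (\<Prod>j<n. di j - c j * lo (j - 1))"
    using prod.distinct_set_conv_list[of "[0..<n]" "\<lambda>j. di j - c j * lo (j - 1)"]
    by (simp add: lessThan_atLeast0)
  finally show ?thesis .
qed

section \<open>Central elements and evaluation maps\<close>

lemma free_alg_induct [case_names add single]:
  fixes f :: "'a::comm_ring_1 free_alg"
  assumes add: "\<And>f g. P f \<Longrightarrow> P g \<Longrightarrow> P (f + g)"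
    and single: "\<And>w c. P (Poly_Mapping.single w c)"
  shows "P f"
proof (induction f rule: update_induct)
  case const
  show ?case using single[of 0 0] by simp
next
  case (update f a b)
  have "Poly_Mapping.update a b f = Poly_Mapping.single a b + f"
    using update(1) by (intro poly_mapping_eqI)
      (auto simp: lookup_update lookup_add lookup_single when_def in_keys_iff)
  then show ?case using add[OF single update(3)] by simp
qed

lemma single_zero_commute:
  fixes f :: "'a::comm_ring_1 free_alg"
  shows "Poly_Mapping.single 0 c * f = f * Poly_Mapping.single 0 c"
  by (induction f rule: free_alg_induct) (simp_all add: algebra_simps mult_single)

lemma const_radial_add: "const_radial (a + b) = const_radial a + const_radial b"
  by transfer (simp add: single_add radial_rel_def radial_ideal.zero)

lemma const_radial_mult: "const_radial (a * b) = const_radial a * const_radial b"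
  by transfer (simp add: mult_single radial_rel_def radial_ideal.zero)

lemma const_radial_1: "const_radial 1 = 1"
  by transfer (simp add: radial_rel_def radial_ideal.zero)

lemma const_radial_0: "const_radial 0 = 0"
  by transfer (simp add: radial_rel_def radial_ideal.zero)

lemma const_radial_commute: "const_radial a * F = F * const_radial a"
  by transfer (simp add: single_zero_commute radial_rel_def radial_ideal.zero)

text \<open>A word is a product of generators, peeled off here from the left; the induction thus
  matches \<open>gen_act\<close>, which is left multiplication.\<close>

lemma radial_induct [case_names const add gen_mult]:
  fixes F :: "'a::comm_ring_1 radial"
  assumes const: "\<And>c. P (const_radial c)"
    and add: "\<And>F G. P F \<Longrightarrow> P G \<Longrightarrow> P (F + G)"
    and gen_mult: "\<And>g F. P F \<Longrightarrow> P (gen_radial g * F)"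
  shows "P F"
proof -
  have "P (abs_radial f)" for f
  proof (induction f rule: free_alg_induct)
    case (add f g)
    then show ?case using assms(2) by (simp flip: plus_radial.abs_eq)
  next
    case (single w c)
    have "P (abs_radial (Poly_Mapping.single (Wrd l) c))" for l
    proof (induction l)
      case Nil
      show ?case using const[of c] by (simp add: const_radial.abs_eq zero_wrd_def)
    next
      case (Cons g l)
      have "Poly_Mapping.single (Wrd (g # l)) c = free_gen g * Poly_Mapping.single (Wrd l) c"
        by (simp add: free_gen_def mult_single plus_wrd_def)
      then show ?case using gen_mult[OF Cons]
        by (simp add: gen_radial.abs_eq times_radial.abs_eq)
    qed
    then show ?case by (cases w) simp
  qed
  then show ?thesis by (metis Quotient3_abs_rep[OF Quotient3_radial])
qed

section \<open>Centrality of the scalars\<close>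

definition central :: "'a::ring \<Rightarrow> bool" where
  "central z \<longleftrightarrow> (\<forall>a. z * a = a * z)"

lemma central_add: "central a \<Longrightarrow> central b \<Longrightarrow> central (a + b)"
  by (simp add: central_def algebra_simps)

lemma central_mult: "central a \<Longrightarrow> central b \<Longrightarrow> central (a * b)"
  unfolding central_def by (metis (no_types, opaque_lifting) mult.assoc)

lemma central_left_commute: "central z \<Longrightarrow> z * (a * b) = a * (z * b)"
  unfolding central_def by (metis (no_types, opaque_lifting) mult.assoc)

lemma central_const_radial: "central (const_radial c)"
  by (simp add: central_def const_radial_commute)

lemma central_radialI:
  fixes z :: "'a::comm_ring_1 radial"
  assumes gen: "\<And>g. z * gen_radial g = gen_radial g * z"
  shows "central z"
  unfolding central_def
proof
  fix F show "z * F = F * z"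
  proof (induction F rule: radial_induct)
    case (const c)
    show ?case by (rule const_radial_commute[symmetric])
  next
    case (add F G)
    then show ?case by (simp add: algebra_simps)
  next
    case (gen_mult g F)
    have "z * (gen_radial g * F) = gen_radial g * (z * F)"
      by (simp add: gen flip: mult.assoc)
    then show ?case by (simp add: gen_mult mult.assoc)
  qed
qed

lemma central_anticommutator_gen_radial:
  "central (anticommutator (gen_radial u) (gen_radial v))"
proof (rule central_radialI)
  fix g
  have "commutator (anticommutator (gen_radial u) (gen_radial v)) (gen_radial g) = (0 :: 'a radial)"
    unfolding commutator_def anticommutator_def
    by transfer (use radial_ideal.relation in
        \<open>simp add: radial_rel_def commutator_def anticommutator_def\<close>)
  then show "anticommutator (gen_radial u) (gen_radial v) * gen_radial g
      = (gen_radial g * anticommutator (gen_radial u) (gen_radial v) :: 'a radial)"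
    by (simp add: commutator_def)
qed

definition half :: RB where "half = const_radial (real_BB (1 / 2))"

lemma half_add_half: "half + half = 1"
  by (simp add: half_def real_BB_half const_radial_1 flip: const_radial_add)

lemma central_half: "central half"
  by (simp add: half_def central_const_radial)

text \<open>The relations give centrality of \<open>{g, g} = 2 g^2\<close>; the scalar 1/2 of the
  coefficient ring turns this into centrality of \<open>g^2\<close>.\<close>

lemma central_square_gen_radial: "central (gen_radial g ^ 2 :: RB)"
proof -
  have "gen_radial g ^ 2 = (half + half) * gen_radial g ^ 2"
    by (simp add: half_add_half)
  also have "\<dots> = half * anticommutator (gen_radial g) (gen_radial g)"
    by (simp add: anticommutator_def power2_eq_square algebra_simps)
  finally show ?thesis
    by (simp add: central_mult central_half central_anticommutator_gen_radial)
qed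

section \<open>Evaluation homomorphisms with central image\<close>

definition central_hom :: "('a::comm_ring_1 \<Rightarrow> 'b::ring_1) \<Rightarrow> bool" where
  "central_hom h \<longleftrightarrow> h 1 = 1 \<and> (\<forall>a b. h (a + b) = h a + h b) \<and>
     (\<forall>a b. h (a * b) = h a * h b) \<and> (\<forall>a. central (h a))"

lemma central_hom_0: "central_hom h \<Longrightarrow> h 0 = 0"
  unfolding central_hom_def using add_cancel_left_left[of "h 0" "h 0"] by (metis add.right_neutral)

lemma poly_eval_with_eq_sum:
  assumes "h 0 = 0" "degree p \<le> n"
  shows "poly_eval_with h u p = (\<Sum>i\<le>n. h (coeff p i) * u ^ i)"
  unfolding poly_eval_with_def using assms
  by (intro sum.mono_neutral_left) (auto simp: coeff_eq_0)

lemma poly_eval_with_pCons: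
  assumes "central_hom h" "central u"
  shows "poly_eval_with h u (pCons a p) = h a + u * poly_eval_with h u p"
proof -
  have "poly_eval_with h u (pCons a p) = (\<Sum>i\<le>Suc (degree p). h (coeff (pCons a p) i) * u ^ i)"
    by (intro poly_eval_with_eq_sum central_hom_0 assms degree_pCons_le)
  also have "\<dots> = h a + (\<Sum>i\<le>degree p. h (coeff p i) * u ^ Suc i)"
    by (subst sum.atMost_Suc_shift) simp
  also have "(\<Sum>i\<le>degree p. h (coeff p i) * u ^ Suc i) = u * poly_eval_with h u p"
    unfolding poly_eval_with_def sum_distrib_left
    by (intro sum.cong refl) (simp add: central_left_commute[OF assms(2)])
  finally show ?thesis .
qed

lemma poly_eval_with_add:
  assumes "central_hom h"
  shows "poly_eval_with h u (p + q) = poly_eval_with h u p + poly_eval_with h u q"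
proof -
  let ?n = "max (degree p) (degree q)"
  have "h 0 = 0" using assms by (rule central_hom_0)
  then have "poly_eval_with h u p = (\<Sum>i\<le>?n. h (coeff p i) * u ^ i)"
    "poly_eval_with h u q = (\<Sum>i\<le>?n. h (coeff q i) * u ^ i)"
    "poly_eval_with h u (p + q) = (\<Sum>i\<le>?n. h (coeff (p + q) i) * u ^ i)"
    by (simp_all only: poly_eval_with_eq_sum degree_add_le_max max.cobounded1 max.cobounded2)
  then show ?thesis
    using assms by (simp add: central_hom_def sum.distrib algebra_simps)
qed

lemma poly_eval_with_const:
  "central_hom h \<Longrightarrow> poly_eval_with h u [:a:] = h a"
  using poly_eval_with_eq_sum[of h "[:a:]" 0 u] central_hom_0[of h] by simp

lemma poly_eval_with_X:
  "central_hom h \<Longrightarrow> central u \<Longrightarrow> poly_eval_with h u [:0, 1:] = u"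
  using poly_eval_with_pCons[of h u 0 "[:1:]"] poly_eval_with_const[of h u 1] central_hom_0[of h]
  by (simp add: central_hom_def)

text \<open>One storey of the tower \<open>BB\<close>, \<open>BB[t]\<close>,
  \<open>BB[t][s]\<close>, \<open>BB[t][s][r]\<close>. Centrality of \<open>u\<close> makes
  evaluation multiplicative in a noncommutative target; as the values of \<open>h\<close> are
  central too, so are the new values, and the result can serve as coefficient map of the next
  storey.\<close>

lemma central_hom_poly_eval_with:
  assumes h: "central_hom h" and u: "central u"
  shows "central_hom (poly_eval_with h u)"
proof -
  let ?e = "poly_eval_with h u"
  have e0: "?e 0 = 0"
    using poly_eval_with_const[OF h, of u 0] central_hom_0[OF h] by simp
  have central: "central (?e p)" for p
  proof (induction p)
    case 0
    show ?case by (simp add: e0 central_def)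
  next
    case (pCons a p)
    then show ?case
      using h u by (auto simp: poly_eval_with_pCons central_hom_def intro: central_add central_mult)
  qed
  have smult: "?e (smult a p) = h a * ?e p" for a p
  proof (induction p)
    case 0
    show ?case by (simp add: e0)
  next
    case (pCons b p)
    have "u * (h a * ?e p) = h a * (u * ?e p)"
      by (rule central_left_commute[OF u])
    then show ?case
      using pCons h u by (simp add: poly_eval_with_pCons central_hom_def algebra_simps)
  qed
  have mult: "?e (p * q) = ?e p * ?e q" for p q
  proof (induction p)
    case 0
    show ?case by (simp add: e0)
  next
    case (pCons a p)
    then show ?case
      using h u central_hom_0[OF h]
      by (simp add: mult_pCons_left poly_eval_with_add smult poly_eval_with_pCons algebra_simps)
  qed
  show ?thesis
    using h central mult poly_eval_with_const[OF h, of u 1]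
    by (simp add: central_hom_def poly_eval_with_add[OF h] one_pCons)
qed

lemma central_hom_const_radial: "central_hom const_radial"
  by (simp add: central_hom_def const_radial_1 const_radial_add const_radial_mult
      central_const_radial)

lemma central_yv2: "central (yv ^ 2)"
  unfolding yv_def by (rule central_square_gen_radial)

lemma central_xv2: "central (xv ^ 2)"
  unfolding xv_def by (rule central_square_gen_radial)

lemma central_anticommutator_xv_yv: "central (anticommutator xv yv)"
  unfolding xv_def yv_def by (rule central_anticommutator_gen_radial)

lemma central_hom_eval_t: "central_hom eval_t"
  unfolding eval_t_def by (intro central_hom_poly_eval_with central_hom_const_radial central_yv2)

lemma central_hom_eval_s: "central_hom (poly_eval_with eval_t (anticommutator xv yv))"
  by (intro central_hom_poly_eval_with central_hom_eval_t central_anticommutator_xv_yv)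

lemma central_hom_eval_scalar: "central_hom eval_scalar"
  unfolding eval_scalar_def
  by (intro central_hom_poly_eval_with central_hom_eval_s central_xv2)

definition t_var :: scalar where "t_var = [:[:[:0, 1:]:]:]"

lemma eval_scalar_add: "eval_scalar (f + g) = eval_scalar f + eval_scalar g"
  and eval_scalar_mult: "eval_scalar (f * g) = eval_scalar f * eval_scalar g"
  and central_eval_scalar: "central (eval_scalar f)"
  using central_hom_eval_scalar by (auto simp: central_hom_def)

lemma eval_scalar_0: "eval_scalar 0 = 0"
  by (rule central_hom_0[OF central_hom_eval_scalar])

lemma eval_scalar_commute: "eval_scalar f * F = F * eval_scalar f"
  using central_eval_scalar[of f] by (simp add: central_def)

lemma eval_scalar_minus: "eval_scalar (- f) = - eval_scalar f"
  by (metis add_eq_0_iff eval_scalar_0 eval_scalar_add)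

lemma eval_scalar_const_t: "eval_scalar [:[:c:]:] = eval_t c"
  by (simp add: eval_scalar_def poly_eval_with_const central_hom_eval_s central_hom_eval_t)

lemma eval_t_const: "eval_t [:c:] = const_radial c"
  by (simp add: eval_t_def poly_eval_with_const central_hom_const_radial)

lemma eval_scalar_const: "eval_scalar (const_scalar c) = const_radial c"
  by (simp add: const_scalar_def eval_scalar_const_t eval_t_const)

lemma eval_scalar_r: "eval_scalar r_var = xv ^ 2"
  by (simp add: eval_scalar_def r_var_def poly_eval_with_X central_hom_eval_s central_xv2)

lemma eval_scalar_s: "eval_scalar s_var = anticommutator xv yv"
  by (simp add: eval_scalar_def s_var_def poly_eval_with_const poly_eval_with_X central_hom_eval_s
      central_hom_eval_t central_anticommutator_xv_yv)

lemma eval_scalar_t: "eval_scalar t_var = yv ^ 2"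
  unfolding t_var_def eval_scalar_const_t
  by (simp add: eval_t_def poly_eval_with_X central_hom_const_radial central_yv2)

section \<open>Freeness of the radial algebra\<close>

text \<open>
  \<open>(f\<^sub>0, f\<^sub>1, f\<^sub>2, f\<^sub>3)\<close> stands for \<open>f\<^sub>0 + y f\<^sub>1 + x f\<^sub>2 + yx f\<^sub>3\<close>, and \<open>gen_act\<close> is left multiplication by a
  generator. The relations hold for these operators, so the action of the free algebra on
  \<open>(1, 0, 0, 0)\<close> factors through the radial algebra and reads off coordinates there.
\<close>

type_synonym quad = "scalar \<times> scalar \<times> scalar \<times> scalar"

fun quad_scale :: "scalar \<Rightarrow> quad \<Rightarrow> quad" where
  "quad_scale c (f0, f1, f2, f3) = (c * f0, c * f1, c * f2, c * f3)"

fun gen_act :: "gen \<Rightarrow> quad \<Rightarrow> quad" where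
  "gen_act Gx (f0, f1, f2, f3) =
     (s_var * f1 + r_var * f2, - (r_var * f3), f0 + s_var * f3, - f1)"
| "gen_act Gy (f0, f1, f2, f3) = (t_var * f1, f0, t_var * f3, f2)"

definition word_act :: "wrd \<Rightarrow> quad \<Rightarrow> quad" where
  "word_act w = foldr gen_act (letters w)"

definition free_act :: "BB free_alg \<Rightarrow> quad \<Rightarrow> quad" where
  "free_act f v =
     (\<Sum>w\<in>Poly_Mapping.keys f. quad_scale (const_scalar (Poly_Mapping.lookup f w)) (word_act w v))"

lemma const_scalar_simps:
  "const_scalar 0 = 0" "const_scalar 1 = 1" "const_scalar (a + b) = const_scalar a + const_scalar b"
  "const_scalar (a * b) = const_scalar a * const_scalar b"
  by (simp_all add: const_scalar_def one_pCons)

lemma quad_scale_0 [simp]: "quad_scale 0 v = 0" "quad_scale c 0 = 0"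
  by (cases v, simp_all add: zero_prod_def)

lemma quad_scale_1 [simp]: "quad_scale 1 v = v"
  by (cases v) simp

lemma quad_scale_add: "quad_scale c (u + v) = quad_scale c u + quad_scale c v"
  by (cases u; cases v) (simp add: algebra_simps)

lemma quad_scale_add_left: "quad_scale (a + b) v = quad_scale a v + quad_scale b v"
  by (cases v) (simp add: algebra_simps)

lemma quad_scale_scale: "quad_scale a (quad_scale b v) = quad_scale (a * b) v"
  by (cases v) (simp add: algebra_simps)

lemma gen_act_add: "gen_act g (u + v) = gen_act g u + gen_act g v"
  by (cases g; cases u; cases v) (simp_all add: algebra_simps)

lemma gen_act_scale: "gen_act g (quad_scale c v) = quad_scale c (gen_act g v)"
  by (cases g; cases v) (simp_all add: algebra_simps)

lemma word_act_add: "word_act w (u + v) = word_act w u + word_act w v"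
proof -
  have "foldr gen_act l (u + v) = foldr gen_act l u + foldr gen_act l v" for l
    by (induction l) (simp_all add: gen_act_add)
  then show ?thesis by (simp add: word_act_def)
qed

lemma word_act_scale: "word_act w (quad_scale c v) = quad_scale c (word_act w v)"
proof -
  have "foldr gen_act l (quad_scale c v) = quad_scale c (foldr gen_act l v)" for l
    by (induction l) (simp_all add: gen_act_scale)
  then show ?thesis by (simp add: word_act_def)
qed

lemma word_act_plus: "word_act (w + w') v = word_act w (word_act w' v)"
  by (simp add: word_act_def plus_wrd_def)

lemma free_act_eq_sum:
  assumes "finite S" "Poly_Mapping.keys f \<subseteq> S"
  shows "free_act f v = (\<Sum>w\<in>S. quad_scale (const_scalar (Poly_Mapping.lookup f w)) (word_act w v))"
  unfolding free_act_def using assms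
  by (intro sum.mono_neutral_left) (auto simp: in_keys_iff const_scalar_simps)

lemma free_act_add: "free_act (f + g) v = free_act f v + free_act g v"
proof -
  let ?S = "Poly_Mapping.keys f \<union> Poly_Mapping.keys g"
  have "free_act h v = (\<Sum>w\<in>?S. quad_scale (const_scalar (Poly_Mapping.lookup h w)) (word_act w v))"
    if "Poly_Mapping.keys h \<subseteq> ?S" for h
    using that by (intro free_act_eq_sum) auto
  then show ?thesis
    using Poly_Mapping.keys_add[of f g]
    by (simp add: lookup_add const_scalar_simps quad_scale_add_left sum.distrib)
qed

lemma free_act_single: "free_act (Poly_Mapping.single w c) v = quad_scale (const_scalar c) (word_act w v)"
  by (subst free_act_eq_sum[of "{w}"]) auto

lemma free_act_add_right: "free_act f (u + v) = free_act f u + free_act f v"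
  unfolding free_act_def by (simp add: word_act_add quad_scale_add sum.distrib)

lemma free_act_mult: "free_act (f * g) v = free_act f (free_act g v)"
proof (induction f arbitrary: v rule: free_alg_induct)
  case (add f f')
  then show ?case by (simp add: distrib_right free_act_add)
next
  case (single w c)
  show ?case
  proof (induction g rule: free_alg_induct)
    case (add g g')
    then show ?case by (simp add: distrib_left free_act_add free_act_add_right)
  next
    case (single w' c')
    show ?case
      by (simp add: mult_single free_act_single word_act_plus word_act_scale quad_scale_scale
          const_scalar_simps)
  qed
qed

lemma free_act_0: "free_act 0 v = 0"
  by (simp add: free_act_def)

lemma free_act_0_right: "free_act f 0 = 0"
  using free_act_add_right[of f 0 0] by simp

lemma free_act_minus: "free_act (- f) v = - free_act f v"
  using free_act_add[of f "- f" v] by (simp add: free_act_0 eq_neg_iff_add_eq_0 add.commute)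

lemma free_act_diff: "free_act (f - g) v = free_act f v - free_act g v"
  using free_act_add[of f "- g" v] by (simp add: free_act_minus)

lemma free_act_gen: "free_act (free_gen g) v = gen_act g v"
  by (simp add: free_gen_def free_act_single const_scalar_simps word_act_def)

text \<open>The eight instances of the relation are checked on a generic quadruple. The vector must
  be arbitrary: in a right multiple \<open>a * c\<close> the ideal element \<open>a\<close> acts on
  \<open>free_act c v\<close>.\<close>

lemma free_act_radial_ideal: "f \<in> radial_ideal \<Longrightarrow> free_act f v = 0"
proof (induction arbitrary: v rule: radial_ideal.induct)
  case (relation a b c)
  obtain f0 f1 f2 f3 where v: "v = (f0, f1, f2, f3)" by (cases v)
  show ?case
    unfolding commutator_def anticommutator_def v distrib_right distrib_left free_act_diff
      free_act_add free_act_mult free_act_gen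
    by (cases a; cases b; cases c) (simp_all add: algebra_simps zero_prod_def)
qed (simp_all add: free_act_0 free_act_add free_act_mult free_act_0_right)

lift_definition coords :: "RB \<Rightarrow> quad" is "\<lambda>f. free_act f (1, 0, 0, 0)"
proof -
  fix f g :: "BB free_alg"
  assume "radial_rel f g"
  then have "free_act (f - g) (1, 0, 0, 0) = 0"
    unfolding radial_rel_def by (rule free_act_radial_ideal)
  then show "free_act f (1, 0, 0, 0) = free_act g (1, 0, 0, 0)"
    by (simp add: free_act_diff)
qed

lemma coords_add: "coords (F + G) = coords F + coords G"
  by transfer (rule free_act_add)

lemma coords_0: "coords 0 = 0"
  using coords_add[of 0 0] by simp

lemma coords_minus: "coords (- F) = - coords F"
  using coords_add[of F "- F"] by (simp add: coords_0 eq_neg_iff_add_eq_0 add.commute)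

lemma coords_diff: "coords (F - G) = coords F - coords G"
  using coords_add[of F "- G"] by (simp add: coords_minus)

lemma coords_gen_mult: "coords (gen_radial g * F) = gen_act g (coords F)"
  by transfer (simp add: free_act_mult free_act_gen)

lemma coords_const_mult: "coords (const_radial c * F) = quad_scale (const_scalar c) (coords F)"
  by transfer (simp add: free_act_mult free_act_single word_act_def zero_wrd_def)

lemma coords_1: "coords 1 = (1, 0, 0, 0)"
  by transfer (simp add: free_act_single word_act_def zero_wrd_def const_scalar_simps
      flip: single_one)

lemma coords_yv_mult: "coords (yv * F) = gen_act Gy (coords F)"
  and coords_xv_mult: "coords (xv * F) = gen_act Gx (coords F)"
  unfolding xv_def yv_def by (rule coords_gen_mult)+

text \<open>Two applications of \<open>gen_act\<close> show that \<open>y^2\<close> acts on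
  quadruples as multiplication by \<open>t\<close>; the rest is induction along the coefficients.
  The same argument serves \<open>s\<close> and \<open>r\<close> in
  \<open>coords_eval_scalar_mult\<close>.\<close>

lemma coords_eval_t_mult: "coords (eval_t p * F) = quad_scale [:[:p:]:] (coords F)"
proof (induction p)
  case 0
  show ?case by (simp add: coords_0 eval_t_def poly_eval_with_def const_radial_0)
next
  case (pCons a p)
  have "[:[:pCons a p:]:] = const_scalar a + t_var * [:[:p:]:]"
    by (simp add: const_scalar_def t_var_def)
  moreover have "coords (yv ^ 2 * G) = quad_scale t_var (coords G)" for G
    by (cases "coords G") (simp add: power2_eq_square mult.assoc coords_yv_mult)
  moreover have "eval_t (pCons a p) = const_radial a + yv ^ 2 * eval_t p"
    unfolding eval_t_def by (intro poly_eval_with_pCons central_hom_const_radial central_yv2)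
  ultimately show ?case
    using pCons by (simp add: distrib_right coords_add coords_const_mult mult.assoc
        quad_scale_add_left quad_scale_scale)
qed

lemma coords_eval_scalar_mult: "coords (eval_scalar f * F) = quad_scale f (coords F)"
proof -
  let ?s = "anticommutator xv yv"
  have s: "coords (poly_eval_with eval_t ?s p * F) = quad_scale [:p:] (coords F)" for p F
  proof (induction p)
    case 0
    show ?case using coords_eval_t_mult[of 0 F] by (simp add: poly_eval_with_def)
  next
    case (pCons a p)
    have "[:pCons a p:] = [:[:a:]:] + s_var * [:p:]"
      by (simp add: s_var_def)
    moreover have "coords (?s * G) = quad_scale s_var (coords G)" for G
      by (cases "coords G") (simp add: anticommutator_def distrib_right mult.assoc coords_add
          coords_xv_mult coords_yv_mult algebra_simps)
    moreover have "poly_eval_with eval_t ?s (pCons a p) = eval_t a + ?s * poly_eval_with eval_t ?s p"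
      by (intro poly_eval_with_pCons central_hom_eval_t central_anticommutator_xv_yv)
    ultimately show ?case
      using pCons by (simp add: distrib_right coords_add coords_eval_t_mult mult.assoc
          quad_scale_add_left quad_scale_scale)
  qed
  show ?thesis
  proof (induction f)
    case 0
    show ?case using s[of 0 F] by (simp add: eval_scalar_def poly_eval_with_def)
  next
    case (pCons a p)
    have "pCons a p = [:a:] + r_var * p"
      by (simp add: r_var_def)
    moreover have "coords (xv ^ 2 * G) = quad_scale r_var (coords G)" for G
      by (cases "coords G") (simp add: power2_eq_square mult.assoc coords_xv_mult algebra_simps)
    moreover have "eval_scalar (pCons a p) = poly_eval_with eval_t ?s a + xv ^ 2 * eval_scalar p"
      unfolding eval_scalar_def
      by (intro poly_eval_with_pCons central_hom_eval_s central_xv2)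
    ultimately show ?case
      using pCons by (simp add: distrib_right coords_add s mult.assoc
          quad_scale_add_left quad_scale_scale)
  qed
qed

section \<open>Bijectivity of the coordinate map\<close>

fun from_coords :: "quad \<Rightarrow> RB" where
  "from_coords (f0, f1, f2, f3) =
     eval_scalar f0 + yv * eval_scalar f1 + xv * eval_scalar f2 + yv * xv * eval_scalar f3"

lemma coords_eval_scalar: "coords (eval_scalar f) = (f, 0, 0, 0)"
  using coords_eval_scalar_mult[of f 1] by (simp add: coords_1)

lemma coords_from_coords: "coords (from_coords v) = v"
  by (cases v) (simp add: coords_add coords_eval_scalar coords_xv_mult coords_yv_mult mult.assoc)

lemma from_coords_add: "from_coords (u + v) = from_coords u + from_coords v"
  by (cases u; cases v) (simp add: eval_scalar_add algebra_simps)

lemma xv_yv: "xv * yv = eval_scalar s_var - yv * xv"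
  by (simp add: eval_scalar_s anticommutator_def)

lemma xv_xv: "xv * xv = eval_scalar r_var"
  by (simp add: eval_scalar_r power2_eq_square)

lemma yv_yv: "yv * yv = eval_scalar t_var"
  by (simp add: eval_scalar_t power2_eq_square)

lemma from_coords_gen_act: "from_coords (gen_act g v) = gen_radial g * from_coords v"
proof -
  obtain f0 f1 f2 f3 where v: "v = (f0, f1, f2, f3)" by (cases v)
  \<comment> \<open>The reordering behind the \<open>f3\<close> entries of
    \<open>gen_act Gx\<close>: \<open>x (yx) = (s - yx) x = s x - r y\<close>.\<close>
  have xyx: "xv * (yv * xv) = xv * eval_scalar s_var - yv * eval_scalar r_var"
  proof -
    have "xv * (yv * xv) = (eval_scalar s_var - yv * xv) * xv"
      by (simp add: xv_yv flip: mult.assoc)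
    also have "\<dots> = eval_scalar s_var * xv - yv * (xv * xv)"
      by (simp add: left_diff_distrib mult.assoc)
    finally show ?thesis by (simp add: xv_xv eval_scalar_commute)
  qed
  show ?thesis
  proof (cases g)
    case Gx
    have "xv * from_coords v = xv * eval_scalar f0 + (xv * yv) * eval_scalar f1
        + (xv * xv) * eval_scalar f2 + (xv * (yv * xv)) * eval_scalar f3"
      by (simp add: v distrib_left mult.assoc)
    also have "\<dots> = from_coords (gen_act g v)"
      unfolding xyx xv_xv xv_yv
      by (simp add: v Gx eval_scalar_add eval_scalar_mult eval_scalar_minus algebra_simps)
    finally show ?thesis by (simp add: xv_def Gx)
  next
    case Gy
    have "yv * from_coords v = yv * eval_scalar f0 + (yv * yv) * eval_scalar f1
        + (yv * xv) * eval_scalar f2 + (yv * yv) * xv * eval_scalar f3"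
      by (simp add: v distrib_left mult.assoc)
    also have "\<dots> = from_coords (gen_act g v)"
      unfolding yv_yv eval_scalar_commute[of t_var xv]
      by (simp add: v Gy eval_scalar_add eval_scalar_mult algebra_simps)
    finally show ?thesis by (simp add: yv_def Gy)
  qed
qed

text \<open>The image of \<open>from_coords\<close> contains the constants and is stable under sums
  and left multiplication by generators, so \<open>1, y, x, yx\<close> span. Their independence is
  the opposite composition, \<open>coords_from_coords\<close>.\<close>

lemma from_coords_coords: "from_coords (coords F) = F"
proof (induction F rule: radial_induct)
  case (const c)
  show ?case
    using coords_eval_scalar[of "const_scalar c"] by (simp add: eval_scalar_const eval_scalar_0)
next
  case (add F G)
  then show ?case by (simp add: coords_add from_coords_add)
next
  case (gen_mult g F)
  then show ?case by (simp add: coords_gen_mult from_coords_gen_act)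
qed

section \<open>The derivative in coordinates\<close>

text \<open>Division-free form of \<open>(f(u) - f(P u)) / ((1 - P) u)\<close>: the geometric sum
  stands for \<open>(1 - P^(i+1)) / (1 - P)\<close>, so the coefficients stay in the given
  ring.\<close>

definition q_deriv :: "'a::comm_ring_1 \<Rightarrow> 'a poly \<Rightarrow> 'a poly" where
  "q_deriv P f = Poly (map (\<lambda>i. (\<Sum>j<Suc i. P ^ j) * coeff f (Suc i)) [0..<degree f])"

lemma coeff_q_deriv: "coeff (q_deriv P f) i = (\<Sum>j<Suc i. P ^ j) * coeff f (Suc i)"
  by (auto simp: q_deriv_def nth_default_def coeff_eq_0)

lemma q_deriv_0 [simp]: "q_deriv P 0 = 0"
  by (simp add: q_deriv_def)

lemma mult_q_deriv: "[:0, 1 - P:] * q_deriv P f = f - pcompose f [:0, P:]"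
proof (rule poly_eqI)
  fix i
  show "coeff ([:0, 1 - P:] * q_deriv P f) i = coeff (f - pcompose f [:0, P:]) i"
  proof (cases i)
    case (Suc j)
    have "(1 - P) * (\<Sum>l<i. P ^ l) = 1 - P ^ i"
      by (rule one_diff_power_eq[symmetric])
    then have "(1 - P) * ((\<Sum>l<i. P ^ l) * coeff f i) = (1 - P ^ i) * coeff f i"
      by (simp only: flip: mult.assoc)
    then show ?thesis
      by (simp add: Suc coeff_q_deriv coeff_pcompose_linear left_diff_distrib del: power_Suc sum.lessThan_Suc)
  qed (simp add: coeff_pcompose_linear poly_0_coeff_0)
qed

text \<open>\<open>q_deriv\<close> solves the defining equation, and the solution is unique because
  \<open>1 - P\<close> is nonzero and the scalars form an integral domain. The same holds for
  \<open>s\<close>, whose quotient is taken in each coefficient of \<open>r\<close>.\<close>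

lemma delta_r_eq:
  assumes "P \<noteq> 1"
  shows "delta_r P f = q_deriv [:[:P:]:] f"
proof -
  have eq: "const_scalar (1 - P) * r_var = [:0, 1 - [:[:P:]:]:]"
    by (simp add: const_scalar_def r_var_def one_pCons)
  have nz: "const_scalar (1 - P) * r_var \<noteq> 0"
    using assms by (simp add: const_scalar_def r_var_def)
  have sol: "const_scalar (1 - P) * r_var * q_deriv [:[:P:]:] f = f - T_r P f"
    unfolding eq T_r_def by (rule mult_q_deriv)
  show ?thesis
    unfolding delta_r_def
  proof (rule the_equality, rule sol)
    fix g assume "const_scalar (1 - P) * r_var * g = f - T_r P f"
    then have "const_scalar (1 - P) * r_var * g = const_scalar (1 - P) * r_var * q_deriv [:[:P:]:] f"
      by (simp only: sol)
    then show "g = q_deriv [:[:P:]:] f" using nz by (metis mult_cancel_left)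
  qed
qed

lemma delta_s_eq:
  assumes "P \<noteq> 1"
  shows "delta_s P f = map_poly (q_deriv [:P:]) f"
proof -
  have eq: "const_scalar (1 - P) * s_var = [:[:0, 1 - [:P:]:]:]"
    by (simp add: const_scalar_def s_var_def one_pCons)
  have nz: "const_scalar (1 - P) * s_var \<noteq> 0"
    using assms by (simp add: const_scalar_def s_var_def)
  have sol: "const_scalar (1 - P) * s_var * map_poly (q_deriv [:P:]) f = f - T_s P f"
  proof (rule poly_eqI)
    fix i
    have "coeff ([:[:0, 1 - [:P:]:]:] * map_poly (q_deriv [:P:]) f) i
        = [:0, 1 - [:P:]:] * q_deriv [:P:] (coeff f i)"
      by (simp add: coeff_map_poly)
    also have "\<dots> = coeff (f - T_s P f) i"
      unfolding mult_q_deriv by (simp add: T_s_def coeff_map_poly)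
    finally show "coeff (const_scalar (1 - P) * s_var * map_poly (q_deriv [:P:]) f) i
        = coeff (f - T_s P f) i"
      unfolding eq .
  qed
  show ?thesis
    unfolding delta_s_def
  proof (rule the_equality, rule sol)
    fix g assume "const_scalar (1 - P) * s_var * g = f - T_s P f"
    then have "const_scalar (1 - P) * s_var * g
        = const_scalar (1 - P) * s_var * map_poly (q_deriv [:P:]) f"
      by (simp only: sol)
    then show "g = map_poly (q_deriv [:P:]) f" using nz by (metis mult_cancel_left)
  qed
qed

section \<open>The scalar derivative on coefficients and monomials\<close>

lemma scalar_eqI:
  fixes f g :: scalar
  shows "(\<And>i j. coeff (coeff f i) j = coeff (coeff g i) j) \<Longrightarrow> f = g"
  by (rule poly_eqI, rule poly_eqI) simp

lemma const_power:
  fixes c :: "'a::comm_ring_1"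
  shows "[:c:] ^ n = [:c ^ n:]"
  by (induction n) (simp_all add: one_pCons)

lemma sum_const:
  fixes f :: "nat \<Rightarrow> 'a::comm_ring_1"
  shows "(\<Sum>i<n. [:f i:]) = [:\<Sum>i<n. f i:]"
  by (induction n) simp_all

lemma coeff_delta_r:
  "coeff (coeff (delta_r (qpow 2) f) i) j
    = smult (\<Sum>l<Suc i. qpow 2 ^ l) (coeff (coeff f (Suc i)) j)"
proof -
  have "qpow 2 \<noteq> 1" using qpow_neq_1[of 2] by simp
  then show ?thesis
    by (simp add: delta_r_eq coeff_q_deriv const_power sum_const del: sum.lessThan_Suc)
qed

lemma coeff_delta_s:
  "coeff (coeff (T_r (qpow 2) (delta_s (qpow 1) f)) i) j
    = smult (qpow (2 * int i) * qnum (int (Suc j))) (coeff (coeff f i) (Suc j))"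
proof -
  have "qpow 1 \<noteq> 1" using qpow_neq_1[of 1] by simp
  moreover have "qpow 2 ^ i = qpow (2 * int i)"
    by (rule qpow_power)
  ultimately show ?thesis
    by (simp add: delta_s_eq T_r_def coeff_pcompose_linear coeff_map_poly coeff_q_deriv const_power
        sum_const sum_power_q mult.commute del: sum.lessThan_Suc)
qed

lemma d_sc_add: "d_sc (f + g) = d_sc f + d_sc g"
proof -
  have "delta_r (qpow 2) (f + g) = delta_r (qpow 2) f + delta_r (qpow 2) g"
    by (rule scalar_eqI) (simp add: coeff_delta_r smult_add_right del: sum.lessThan_Suc)
  moreover have "T_r (qpow 2) (delta_s (qpow 1) (f + g))
      = T_r (qpow 2) (delta_s (qpow 1) f) + T_r (qpow 2) (delta_s (qpow 1) g)"
    by (rule scalar_eqI) (simp add: coeff_delta_s smult_add_right)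
  ultimately show ?thesis
    by (simp add: d_sc_def eval_scalar_add algebra_simps)
qed

lemma d_sc_0: "d_sc 0 = 0"
  using d_sc_add[of 0 0] by simp

lemma d_sc_minus: "d_sc (- f) = - d_sc f"
  using d_sc_add[of f "- f"] by (simp add: d_sc_0 eq_neg_iff_add_eq_0 add.commute)

text \<open>Both difference quotients act on the exponents of \<open>r\<close> and \<open>s\<close>
  only, so coefficients in \<open>t\<close> pass through; this is the source of the
  \<open>BB[t]\<close>-linearity of \<open>K_op\<close>.\<close>

lemma d_sc_t_linear: "d_sc ([:[:c:]:] * f) = eval_t c * d_sc f"
proof -
  let ?E = "eval_scalar [:[:c:]:]"
  have "delta_r (qpow 2) ([:[:c:]:] * f) = [:[:c:]:] * delta_r (qpow 2) f"
    by (rule scalar_eqI) (simp add: coeff_delta_r del: sum.lessThan_Suc)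
  moreover have "T_r (qpow 2) (delta_s (qpow 1) ([:[:c:]:] * f))
      = [:[:c:]:] * T_r (qpow 2) (delta_s (qpow 1) f)"
    by (rule scalar_eqI) (simp add: coeff_delta_s)
  ultimately have "d_sc ([:[:c:]:] * f) =
      const_radial (1 + qpow 1) * xv * (?E * eval_scalar (delta_r (qpow 2) f))
     + 2 * yv * (?E * eval_scalar (T_r (qpow 2) (delta_s (qpow 1) f)))"
    by (simp only: d_sc_def eval_scalar_mult)
  also have "\<dots> = ?E * d_sc f"
    unfolding d_sc_def distrib_left central_left_commute[OF central_eval_scalar, symmetric] ..
  finally show ?thesis by (simp add: eval_scalar_const_t)
qed

lemma d_sc_const: "d_sc (const_scalar c * f) = const_radial c * d_sc f"
  unfolding const_scalar_def by (simp only: d_sc_t_linear eval_t_const)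

definition rs_monom :: "nat \<Rightarrow> nat \<Rightarrow> scalar" where "rs_monom a b = monom (monom 1 b) a"

lemma coeff_rs_monom: "coeff (coeff (rs_monom a b) i) j = (if i = a \<and> j = b then 1 else 0)"
  by (simp add: rs_monom_def)

lemma r_var_rs_monom: "r_var * rs_monom a b = rs_monom (Suc a) b"
  by (simp add: r_var_def rs_monom_def monom_Suc)

lemma s_var_rs_monom: "s_var * rs_monom a b = rs_monom a (Suc b)"
  by (simp add: s_var_def rs_monom_def monom_Suc smult_monom)

lemma coeff_const_mult: "coeff (coeff (const_scalar c * f) i) j = smult c (coeff (coeff f i) j)"
  by (simp add: const_scalar_def)

text \<open>\<open>a - 1\<close> and \<open>b - 1\<close> are truncated at 0, but there the
  coefficients contain \<open>[0] = 0\<close>, so one formula covers all exponents.\<close>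

lemma d_sc_rs_monom:
  "d_sc (rs_monom a b) =
     xv * eval_scalar (const_scalar (qnum (2 * int a)) * rs_monom (a - 1) b)
     + 2 * yv * eval_scalar (const_scalar (qpow (2 * int a) * qnum (int b)) * rs_monom a (b - 1))"
proof -
  have "const_scalar (1 + qpow 1) * delta_r (qpow 2) (rs_monom a b)
      = const_scalar (qnum (2 * int a)) * rs_monom (a - 1) b"
  proof (rule scalar_eqI)
    fix i j
    have "smult (1 + qpow 1) (coeff (coeff (delta_r (qpow 2) (rs_monom a b)) i) j)
        = smult (qnum (2 * int (Suc i))) (coeff (coeff (rs_monom a b) (Suc i)) j)"
      unfolding coeff_delta_r smult_smult sum_power_q2 ..
    then show "coeff (coeff (const_scalar (1 + qpow 1) * delta_r (qpow 2) (rs_monom a b)) i) j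
        = coeff (coeff (const_scalar (qnum (2 * int a)) * rs_monom (a - 1) b) i) j"
      by (cases a) (auto simp: coeff_const_mult coeff_rs_monom)
  qed
  moreover have "T_r (qpow 2) (delta_s (qpow 1) (rs_monom a b))
      = const_scalar (qpow (2 * int a) * qnum (int b)) * rs_monom a (b - 1)"
    by (rule scalar_eqI, cases b) (auto simp: coeff_delta_s coeff_const_mult coeff_rs_monom)
  ultimately show ?thesis
    unfolding d_sc_def central_const_radial[unfolded central_def, rule_format, of _ xv] mult.assoc
    by (simp only: eval_scalar_const[symmetric] eval_scalar_mult[symmetric])
qed

section \<open>The vector derivative and the operator in coordinates\<close>

definition half_s :: scalar where "half_s = const_scalar (real_BB (1 / 2)) * s_var"

lemma wv_eq: "wv = eval_scalar half_s - yv * xv"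
proof -
  have "wv = half * (eval_scalar s_var - (yv * xv + yv * xv))"
    by (simp add: wv_def half_def commutator_def eval_scalar_s anticommutator_def)
  also have "\<dots> = half * eval_scalar s_var - (half + half) * (yv * xv)"
    by (simp only: right_diff_distrib distrib_left distrib_right)
  also have "\<dots> = half * eval_scalar s_var - yv * xv"
    by (simp only: half_add_half mult_1_left)
  finally show ?thesis
    by (simp add: half_s_def eval_scalar_mult eval_scalar_const half_def)
qed

lemma coords_wv_mult:
  "coords (wv * F) = quad_scale half_s (coords F) - gen_act Gy (gen_act Gx (coords F))"
  by (simp add: wv_eq left_diff_distrib coords_diff coords_eval_scalar_mult mult.assoc
      coords_xv_mult coords_yv_mult)

text \<open>Since \<open>yx = s/2 - w\<close>, the coordinate \<open>f3\<close> enters twice: as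
  \<open>(s/2) f3\<close> in the scalar part and as \<open>- f3\<close> in the rule for
  \<open>w\<close>, which explains the signs of the last summand.\<close>

definition deriv_formula :: "RB \<Rightarrow> RB" where
  "deriv_formula F = (case coords F of (f0, f1, f2, f3) \<Rightarrow>
     d_sc (f0 + half_s * f3) + yv * d_sc f1
     + (const_radial (qnum_m 0) * eval_scalar f2 + const_radial Q_BB * xv * d_sc f2)
     + (const_radial (qnum_m (- 1)) * yv * eval_scalar f3
        - const_radial (Q_BB * qpow (- 1)) * wv * d_sc f3))"

lemma coords_basis_mult:
  "coords (yv * eval_scalar f) = (0, f, 0, 0)"
  "coords (xv * eval_scalar f) = (0, 0, f, 0)"
  "coords (wv * eval_scalar f) = (half_s * f, 0, 0, - f)"
  by (simp_all add: coords_yv_mult coords_xv_mult coords_wv_mult coords_eval_scalar)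

lemma is_right_q_derivative_deriv_formula: "is_right_q_derivative deriv_formula"
  unfolding is_right_q_derivative_def
proof (intro conjI allI)
  fix F G f c
  show "deriv_formula (F + G) = deriv_formula F + deriv_formula G"
    by (cases "coords F"; cases "coords G")
      (simp add: deriv_formula_def coords_add d_sc_add eval_scalar_add algebra_simps)
  show "deriv_formula (const_radial c * F) = const_radial c * deriv_formula F"
  proof -
    obtain f0 f1 f2 f3 where F: "coords F = (f0, f1, f2, f3)" by (cases "coords F")
    have "d_sc (const_scalar c * f0 + half_s * (const_scalar c * f3))
        = const_radial c * d_sc (f0 + half_s * f3)"
      by (simp only: d_sc_const[symmetric] distrib_left mult.left_commute)
    note this [simp]
    show ?thesis
      by (simp add: deriv_formula_def F coords_const_mult d_sc_const eval_scalar_mult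
        eval_scalar_const distrib_left right_diff_distrib mult.assoc
        central_left_commute[OF central_const_radial[of c]])
  qed
  show "deriv_formula (eval_scalar f) = d_sc f"
    by (simp add: deriv_formula_def coords_eval_scalar d_sc_0 eval_scalar_0)
qed (simp_all add: deriv_formula_def coords_basis_mult d_sc_0 d_sc_minus eval_scalar_0
    eval_scalar_minus)

lemma is_right_q_derivative_imp_eq:
  assumes D: "is_right_q_derivative D"
  shows "D F = deriv_formula F"
proof -
  obtain f0 f1 f2 f3 where F: "coords F = (f0, f1, f2, f3)" by (cases "coords F")
  have add: "D (A + B) = D A + D B" for A B
    using D by (simp add: is_right_q_derivative_def)
  have "F = from_coords (f0, f1, f2, f3)"
    using from_coords_coords[of F] by (simp add: F)
  also have "yv * xv * eval_scalar f3 = eval_scalar (half_s * f3) + wv * eval_scalar (- f3)"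
    by (simp add: wv_eq eval_scalar_mult eval_scalar_minus algebra_simps)
  then have "from_coords (f0, f1, f2, f3) = eval_scalar (f0 + half_s * f3) + yv * eval_scalar f1
      + xv * eval_scalar f2 + wv * eval_scalar (- f3)"
    by (simp add: eval_scalar_add)
  finally have "D F = D (eval_scalar (f0 + half_s * f3)) + D (yv * eval_scalar f1)
      + D (xv * eval_scalar f2) + D (wv * eval_scalar (- f3))"
    by (simp only: add)
  also have "D (wv * eval_scalar (- f3)) = const_radial (qnum_m (- 1)) * yv * eval_scalar f3
        - const_radial (Q_BB * qpow (- 1)) * wv * d_sc f3"
  proof -
    have "D (wv * eval_scalar f) = - const_radial (qnum_m (- 1)) * yv * eval_scalar f
        + const_radial (Q_BB * qpow (- 1)) * wv * d_sc f" for f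
      using D by (simp add: is_right_q_derivative_def)
    from this[of "- f3"] show ?thesis by (simp add: d_sc_minus eval_scalar_minus)
  qed
  finally show ?thesis
    using D by (simp add: is_right_q_derivative_def deriv_formula_def F)
qed

lemma right_q_derivative_eq: "right_q_derivative = deriv_formula"
  unfolding right_q_derivative_def
  by (rule the_equality, rule is_right_q_derivative_deriv_formula)
    (simp add: fun_eq_iff is_right_q_derivative_imp_eq)

text \<open>Right multiplication by \<open>x\<close> sends \<open>1, y, x, yx\<close> to
  \<open>x, yx, r, r y\<close>, so \<open>(f0, f1, f2, f3)\<close> becomes
  \<open>(r f2, r f3, f0, f1)\<close> before the derivative is applied.\<close>

lemma K_op_eq:
  assumes F: "coords F = (f0, f1, f2, f3)"
  shows "K_op F = d_sc (r_var * f2 + half_s * f1) + yv * d_sc (r_var * f3)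
     + (const_radial (qnum_m 0) * eval_scalar f0 + const_radial Q_BB * xv * d_sc f0)
     + (const_radial (qnum_m (- 1)) * yv * eval_scalar f1
        - const_radial (Q_BB * qpow (- 1)) * wv * d_sc f1)"
proof -
  have E: "eval_scalar f * xv = xv * eval_scalar f" for f
    by (rule eval_scalar_commute)
  have "F * xv = from_coords (f0, f1, f2, f3) * xv"
    using from_coords_coords[of F] by (simp add: F)
  also have "\<dots> = xv * eval_scalar f0 + yv * xv * eval_scalar f1
      + (xv * xv) * eval_scalar f2 + yv * (xv * xv) * eval_scalar f3"
    by (simp add: distrib_right mult.assoc E)
  also have "\<dots> = from_coords (r_var * f2, r_var * f3, f0, f1)"
    unfolding xv_xv by (simp add: eval_scalar_mult mult.assoc)
  finally have "coords (F * xv) = (r_var * f2, r_var * f3, f0, f1)"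
    by (simp only: coords_from_coords)
  then show ?thesis
    by (simp add: K_op_def right_q_derivative_eq deriv_formula_def)
qed

lemma K_op_add: "K_op (F + G) = K_op F + K_op G"
  using is_right_q_derivative_deriv_formula
  by (simp add: K_op_def right_q_derivative_eq is_right_q_derivative_def distrib_right)

lemma K_op_t_linear: "K_op (eval_t c * F) = eval_t c * K_op F"
proof -
  obtain f0 f1 f2 f3 where F: "coords F = (f0, f1, f2, f3)" by (cases "coords F")
  let ?c = "[:[:c:]:] :: scalar"
  have cF: "coords (eval_t c * F) = (?c * f0, ?c * f1, ?c * f2, ?c * f3)"
    by (simp only: coords_eval_t_mult F quad_scale.simps)
  have central: "central (eval_t c)" using central_hom_eval_t by (simp add: central_hom_def)
  have eqs: "d_sc (r_var * (?c * f2) + half_s * (?c * f1)) = eval_t c * d_sc (r_var * f2 + half_s * f1)"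
    "d_sc (r_var * (?c * f3)) = eval_t c * d_sc (r_var * f3)"
    by (simp_all only: d_sc_t_linear[symmetric] distrib_left mult.left_commute)
  show ?thesis
    unfolding K_op_eq[OF F] K_op_eq[OF cF]
    by (simp only: eqs d_sc_t_linear eval_scalar_mult eval_scalar_const_t distrib_left
        right_diff_distrib mult.assoc central_left_commute[OF central])
qed

section \<open>Determinants of endomorphisms of free modules\<close>

lemma eval_t_add: "eval_t (a + b) = eval_t a + eval_t b"
  and eval_t_mult: "eval_t (a * b) = eval_t a * eval_t b"
  and eval_t_1: "eval_t 1 = 1"
  using central_hom_eval_t by (auto simp: central_hom_def)

lemma eval_t_0: "eval_t 0 = 0"
  by (rule central_hom_0[OF central_hom_eval_t])

lemma eval_t_diff: "eval_t (a - b) = eval_t a - eval_t b"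
  using eval_t_add[of "a - b" b] by simp

lemma eval_t_sum: "eval_t (sum f A) = (\<Sum>i\<in>A. eval_t (f i))"
  by (induction A rule: infinite_finite_induct) (simp_all add: eval_t_0 eval_t_add)

text \<open>\<open>is_basis_over_t\<close> grants uniqueness only for elements of \<open>H\<close>
  and does not make \<open>H\<close> closed under combinations. Hence uniqueness is applied to 0,
  which both the vector of differences and the zero vector represent.\<close>

lemma is_basis_over_t_coords_eq:
  assumes basis: "is_basis_over_t H bs" and "0 \<in> H"
    and eq: "(\<Sum>i<length bs. eval_t (f i) * bs ! i) = (\<Sum>i<length bs. eval_t (g i) * bs ! i)"
    and i: "i < length bs"
  shows "f i = g i"
proof -
  let ?n = "length bs"
  let ?c = "vec ?n (\<lambda>i. f i - g i)"
  have "(\<Sum>i<?n. eval_t (?c $ i) * bs ! i)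
      = (\<Sum>i<?n. eval_t (f i) * bs ! i) - (\<Sum>i<?n. eval_t (g i) * bs ! i)"
    by (simp add: eval_t_diff left_diff_distrib sum_subtractf)
  then have "0 = (\<Sum>i<?n. eval_t (?c $ i) * bs ! i)" using eq by simp
  moreover have "0 = (\<Sum>i<?n. eval_t (0\<^sub>v ?n $ i) * bs ! i)"
    by (simp add: eval_t_0)
  moreover have "\<exists>!c. c \<in> carrier_vec ?n \<and> 0 = (\<Sum>i<?n. eval_t (c $ i) * bs ! i)"
    using basis \<open>0 \<in> H\<close> unfolding is_basis_over_t_def by blast
  moreover have "?c \<in> carrier_vec ?n" "0\<^sub>v ?n \<in> carrier_vec ?n" by simp_all
  ultimately have "?c = 0\<^sub>v ?n" by blast
  then have "?c $ i = 0\<^sub>v ?n $ i" by simp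
  then show ?thesis using i by simp
qed

lemma basis_change_matrix:
  assumes "is_basis_over_t H bs" "is_basis_over_t H bs'"
  shows "\<exists>P\<in>carrier_mat (length bs) (length bs').
    \<forall>j<length bs'. bs' ! j = (\<Sum>i<length bs. eval_t (P $$ (i, j)) * bs ! i)"
proof -
  have "\<exists>c. bs' ! j = (\<Sum>i<length bs. eval_t (c $ i) * bs ! i)" if "j < length bs'" for j
  proof -
    have "bs' ! j \<in> H" using assms(2) that by (auto simp: is_basis_over_t_def)
    then show ?thesis using assms(1) by (auto simp: is_basis_over_t_def)
  qed
  then obtain c where c: "\<And>j. j < length bs' \<Longrightarrow> bs' ! j = (\<Sum>i<length bs. eval_t (c j $ i) * bs ! i)"
    by metis
  then show ?thesis
    by (intro bexI[of _ "mat (length bs) (length bs') (\<lambda>(i, j). c j $ i)"]) simp_all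
qed

text \<open>Matrix multiplication in disguise: coordinates \<open>f\<close> in the family
  \<open>b'\<close> become coordinates \<open>P f\<close> in the family \<open>b\<close>.\<close>

lemma sum_over_t_substitute:
  assumes "\<And>i. i < m \<Longrightarrow> b' i = (\<Sum>l<n. eval_t (P l i) * b l)"
  shows "(\<Sum>i<m. eval_t (f i) * b' i) = (\<Sum>l<n. eval_t (\<Sum>i<m. P l i * f i) * b l)"
proof -
  have "(\<Sum>i<m. eval_t (f i) * b' i) = (\<Sum>i<m. \<Sum>l<n. eval_t (P l i * f i) * b l)"
    by (simp add: assms sum_distrib_left eval_t_mult mult.commute[of "P _ _"] mult.assoc)
  also have "\<dots> = (\<Sum>l<n. \<Sum>i<m. eval_t (P l i * f i) * b l)"
    by (rule sum.swap)
  finally show ?thesis by (simp add: eval_t_sum sum_distrib_right)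
qed

lemma mat_mult_entry:
  assumes "A \<in> carrier_mat n m" "B \<in> carrier_mat m l" "i < n" "j < l"
  shows "(A * B) $$ (i, j) = (\<Sum>r<m. A $$ (i, r) * B $$ (r, j))"
  using assms by (auto simp: scalar_prod_def lessThan_atLeast0 intro!: sum.cong)

lemma basis_change_inverse:
  assumes bs: "is_basis_over_t H bs" and "0 \<in> H"
    and P: "P \<in> carrier_mat (length bs) (length bs')"
      "\<And>j. j < length bs' \<Longrightarrow> bs' ! j = (\<Sum>i<length bs. eval_t (P $$ (i, j)) * bs ! i)"
    and Q: "Q \<in> carrier_mat (length bs') (length bs)"
      "\<And>j. j < length bs \<Longrightarrow> bs ! j = (\<Sum>i<length bs'. eval_t (Q $$ (i, j)) * bs' ! i)"
  shows "P * Q = 1\<^sub>m (length bs)"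
proof (rule eq_matI)
  fix i j assume "i < dim_row (1\<^sub>m (length bs) :: BB poly mat)" "j < dim_col (1\<^sub>m (length bs) :: BB poly mat)"
  then have ij: "i < length bs" "j < length bs" by auto
  have "bs ! j = (\<Sum>l<length bs. eval_t (\<Sum>i<length bs'. P $$ (l, i) * Q $$ (i, j)) * bs ! l)"
    using Q(2)[OF ij(2)] sum_over_t_substitute[where f = "\<lambda>i. Q $$ (i, j)", OF P(2)] by simp
  moreover have "bs ! j = (\<Sum>l<length bs. eval_t (if l = j then 1 else 0) * bs ! l)"
    using ij by (simp add: if_distrib[of eval_t] eval_t_1 eval_t_0 if_distrib[of "\<lambda>x. x * _"] cong: if_cong)
  ultimately have "(\<Sum>l<length bs. eval_t (\<Sum>i<length bs'. P $$ (l, i) * Q $$ (i, j)) * bs ! l)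
      = (\<Sum>l<length bs. eval_t (if l = j then 1 else 0) * bs ! l)" by simp
  from is_basis_over_t_coords_eq[OF bs \<open>0 \<in> H\<close> this ij(1)]
  show "(P * Q) $$ (i, j) = 1\<^sub>m (length bs) $$ (i, j)"
    using ij mat_mult_entry[OF P(1) Q(1) ij] by simp
qed (use P Q in auto)

text \<open>The matrices of \<open>L\<close> in two bases are conjugate by the base change
  \<open>P\<close>, and \<open>det P\<close> is a unit, so all of them share one
  determinant.\<close>

lemma det_over_t_eqI:
  assumes "0 \<in> H" and add: "\<And>F G. L (F + G) = L F + L G"
    and lin: "\<And>c F. L (eval_t c * F) = eval_t c * L F"
    and bs: "is_basis_over_t H bs" and M: "is_matrix_over_t L bs M"
  shows "det_over_t H L = det M"
proof -
  have "det M' = det M" if bs': "is_basis_over_t H bs'" and M': "is_matrix_over_t L bs' M'" for bs' M'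
  proof -
    obtain P Q where PQ_carrier: "P \<in> carrier_mat (length bs) (length bs')"
        "Q \<in> carrier_mat (length bs') (length bs)"
      and PQ_coords: "\<forall>j<length bs'. bs' ! j = (\<Sum>i<length bs. eval_t (P $$ (i, j)) * bs ! i)"
        "\<forall>j<length bs. bs ! j = (\<Sum>i<length bs'. eval_t (Q $$ (i, j)) * bs' ! i)"
      using basis_change_matrix[OF bs bs'] basis_change_matrix[OF bs' bs] by blast
    note P = PQ_carrier(1) PQ_coords(1)[rule_format] and Q = PQ_carrier(2) PQ_coords(2)[rule_format]
    have PQ: "P * Q = 1\<^sub>m (length bs)"
      by (rule basis_change_inverse[OF bs \<open>0 \<in> H\<close> P Q])
    have QP: "Q * P = 1\<^sub>m (length bs')"
      by (rule basis_change_inverse[OF bs' \<open>0 \<in> H\<close> Q P])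
    define n where "n = length bs"
    \<comment> \<open>The definition of a basis leaves the length open; only after this step are
      \<open>P\<close> and \<open>Q\<close> known to be square.\<close>
    have len: "length bs' = n"
      unfolding n_def using mult_eq_one_mat_imp_le[OF P(1) Q(1) PQ] mult_eq_one_mat_imp_le[OF Q(1) P(1) QP]
      by simp
    have carr: "M \<in> carrier_mat n n" "M' \<in> carrier_mat n n" "P \<in> carrier_mat n n" "Q \<in> carrier_mat n n"
      using M M' P(1) Q(1) by (simp_all add: is_matrix_over_t_def len n_def)
    have L_sum: "L (\<Sum>i<r. G i) = (\<Sum>i<r. L (G i))" for G and r :: nat
    proof (induction r)
      case 0
      show ?case using add[of 0 0] by simp
    qed (simp add: add)
    \<comment> \<open>Both products list the coordinates of \<open>L (bs' ! j)\<close> in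
      \<open>bs\<close>: the first expands the image in \<open>bs'\<close>, the second expands
      \<open>bs' ! j\<close> in \<open>bs\<close> before applying \<open>L\<close>.\<close>
    have "P * M' = M * P"
    proof (rule eq_matI)
      fix i j assume "i < dim_row (M * P)" "j < dim_col (M * P)"
      then have ij: "i < n" "j < n" using carr by auto
      have "L (bs' ! j) = (\<Sum>l<n. eval_t (M' $$ (l, j)) * bs' ! l)"
        using M' ij by (simp add: is_matrix_over_t_def len)
      also have "\<dots> = (\<Sum>l<n. eval_t (\<Sum>r<n. P $$ (l, r) * M' $$ (r, j)) * bs ! l)"
        using P(2) by (intro sum_over_t_substitute) (simp add: len n_def)
      finally have 1: "L (bs' ! j) = (\<Sum>l<length bs. eval_t (\<Sum>r<n. P $$ (l, r) * M' $$ (r, j)) * bs ! l)"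
        by (simp add: n_def)
      have "L (bs' ! j) = (\<Sum>l<n. eval_t (P $$ (l, j)) * L (bs ! l))"
        using P(2)[of j] ij by (simp add: len L_sum lin flip: n_def)
      also have "\<dots> = (\<Sum>l<n. eval_t (\<Sum>r<n. M $$ (l, r) * P $$ (r, j)) * bs ! l)"
        using M by (intro sum_over_t_substitute) (simp add: is_matrix_over_t_def n_def)
      finally have "(\<Sum>l<length bs. eval_t (\<Sum>r<n. P $$ (l, r) * M' $$ (r, j)) * bs ! l)
        = (\<Sum>l<length bs. eval_t (\<Sum>r<n. M $$ (l, r) * P $$ (r, j)) * bs ! l)"
        using 1 by (simp add: n_def)
      from is_basis_over_t_coords_eq[OF bs \<open>0 \<in> H\<close> this, of i]
      show "(P * M') $$ (i, j) = (M * P) $$ (i, j)"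
        using ij carr by (simp only: mat_mult_entry n_def)
    qed (use carr in auto)
    then have "det P * det M' = det M * det P"
      using carr by (metis det_mult)
    moreover have "det P * det Q = 1"
      using carr PQ by (metis det_mult det_one n_def)
    ultimately show ?thesis
      by (metis mult.commute mult_cancel_left mult_zero_left zero_neq_one)
  qed
  then show ?thesis
    unfolding det_over_t_def using bs M by blast
qed

section \<open>A basis of the block\<close>

text \<open>Beyond \<open>j = k\<close> the exponent \<open>k - j\<close> is truncated to 0. The
  values at \<open>j = Suc k\<close>, here and for \<open>v_basis\<close>, occur in the formulas for
  \<open>K_op\<close> only with a factor \<open>[0] = 0\<close>.\<close>

definition u_basis :: "nat \<Rightarrow> nat \<Rightarrow> RB" where
  "u_basis k j = (if even j then 1 else yv * xv) * eval_scalar (rs_monom (j div 2) (k - j))"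

definition v_basis :: "nat \<Rightarrow> nat \<Rightarrow> RB" where
  "v_basis k j = (if even j then yv else xv) * eval_scalar (rs_monom (j div 2) (k - j))"

definition block_basis :: "nat \<Rightarrow> RB list" where
  "block_basis k = map (u_basis k) [0..<Suc k] @ map (v_basis k) [0..<Suc k]"

lemma length_block_basis: "length (block_basis k) = Suc k + Suc k"
  by (simp add: block_basis_def)

lemma nth_block_basis:
  "j < Suc k \<Longrightarrow> block_basis k ! j = u_basis k j"
  "j < Suc k \<Longrightarrow> block_basis k ! (Suc k + j) = v_basis k j"
  by (simp_all add: block_basis_def nth_append del: upt_Suc)

lemma sum_lessThan_add:
  fixes n m :: nat
  shows "(\<Sum>j<n + m. g j) = (\<Sum>j<n. g j) + (\<Sum>j<m. g (n + j))"
  by (induction m) (simp_all add: add.assoc)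

lemma prod_lessThan_add:
  fixes n m :: nat
  shows "(\<Prod>j<n + m. g j) = (\<Prod>j<n. g j) * (\<Prod>j<m. g (n + j))"
  by (induction m) (simp_all add: mult.assoc)

text \<open>Scalar coordinate of a combination of basis vectors: even indices
  (\<open>e = True\<close>) belong to \<open>1\<close> and \<open>y\<close>, odd ones to
  \<open>x\<close> and \<open>yx\<close>.\<close>

definition comb :: "bool \<Rightarrow> nat \<Rightarrow> (nat \<Rightarrow> BB poly) \<Rightarrow> scalar" where
  "comb e k c = (\<Sum>j<Suc k. if even j = e then [:[:c j:]:] * rs_monom (j div 2) (k - j) else 0)"

lemma coords_u_basis: "coords (u_basis k j) =
    (if even j then (rs_monom (j div 2) (k - j), 0, 0, 0) else (0, 0, 0, rs_monom (j div 2) (k - j)))"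
  by (simp add: u_basis_def mult.assoc coords_xv_mult coords_yv_mult coords_eval_scalar)

lemma coords_v_basis: "coords (v_basis k j) =
    (if even j then (0, rs_monom (j div 2) (k - j), 0, 0) else (0, 0, rs_monom (j div 2) (k - j), 0))"
  by (simp add: v_basis_def coords_basis_mult)

lemma coords_sum_block_basis:
  "coords (\<Sum>j<length (block_basis k). eval_t (c j) * block_basis k ! j) =
     (comb True k c, comb True k (\<lambda>j. c (Suc k + j)),
      comb False k (\<lambda>j. c (Suc k + j)), comb False k c)"
proof -
  have "coords (\<Sum>j<m. eval_t (f j) * u_basis k j) =
     (\<Sum>j<m. if even j = True then [:[:f j:]:] * rs_monom (j div 2) (k - j) else 0, 0, 0,
      \<Sum>j<m. if even j = False then [:[:f j:]:] * rs_monom (j div 2) (k - j) else 0)" for f m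
    by (induction m) (simp_all add: coords_0 zero_prod_def coords_add coords_eval_t_mult coords_u_basis)
  moreover have "coords (\<Sum>j<m. eval_t (f j) * v_basis k j) =
     (0, \<Sum>j<m. if even j = True then [:[:f j:]:] * rs_monom (j div 2) (k - j) else 0,
      \<Sum>j<m. if even j = False then [:[:f j:]:] * rs_monom (j div 2) (k - j) else 0, 0)" for f m
    by (induction m) (simp_all add: coords_0 zero_prod_def coords_add coords_eval_t_mult coords_v_basis)
  moreover have "(\<Sum>j<length (block_basis k). eval_t (c j) * block_basis k ! j)
      = (\<Sum>j<Suc k. eval_t (c j) * u_basis k j) + (\<Sum>j<Suc k. eval_t (c (Suc k + j)) * v_basis k j)"
    unfolding length_block_basis sum_lessThan_add
    by (intro arg_cong2[of _ _ _ _ "(+)"] sum.cong refl) (simp_all only: lessThan_iff nth_block_basis)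
  ultimately show ?thesis
    by (simp only: coords_add comb_def) simp
qed

lemma coeff_t_mult: "coeff (coeff ([:[:c:]:] * f) i) j = c * coeff (coeff (f :: scalar) i) j"
  by simp

text \<open>Within one parity class \<open>j div 2\<close> determines \<open>j\<close>, so the
  monomials are distinct and each coefficient can be read off.\<close>

lemma coeff_comb:
  assumes "j \<le> k" "even j = e"
  shows "coeff (coeff (comb e k c) (j div 2)) (k - j) = c j"
proof -
  have "coeff (coeff (comb e k c) (j div 2)) (k - j) =
     (\<Sum>l<Suc k. if l = j then c j else 0)"
    unfolding comb_def coeff_sum
    using assms by (intro sum.cong refl) (auto simp: coeff_t_mult coeff_rs_monom simp del: mult_pCons_left)
  then show ?thesis using assms by simp
qed

lemma homogeneous_scalar_eq_comb:
  assumes f: "homogeneous_scalar (if e then 0 else 1) k f"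
  shows "f = comb e k (\<lambda>j. coeff (coeff f (j div 2)) (k - j))"
proof (rule scalar_eqI)
  fix i j
  let ?d = "if e then 0 else 1 :: nat"
  let ?f = "coeff (coeff f i) j"
  have rhs: "coeff (coeff (comb e k (\<lambda>j. coeff (coeff f (j div 2)) (k - j))) i) j
      = (\<Sum>l<Suc k. if even l = e \<and> l div 2 = i \<and> k - l = j then ?f else 0)"
    unfolding comb_def coeff_sum
    by (intro sum.cong refl) (auto simp: coeff_t_mult coeff_rs_monom simp del: mult_pCons_left)
  show "?f = coeff (coeff (comb e k (\<lambda>j. coeff (coeff f (j div 2)) (k - j))) i) j"
  proof (cases "?f = 0")
    case True
    then show ?thesis by (simp only: rhs if_cancel sum.neutral_const)
  next
    case False
    then have eq: "?d + 2 * i + j = k"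
      using f unfolding homogeneous_scalar_def by blast
    have parity: "(even l = e \<and> l div 2 = i) \<longleftrightarrow> l = ?d + 2 * i" for l
    proof
      show "l = ?d + 2 * i" if "even l = e \<and> l div 2 = i"
        using that even_two_times_div_two[of l] odd_two_times_div_two_succ[of l] by (cases e) auto
    qed (cases e, auto)
    have "(even l = e \<and> l div 2 = i \<and> k - l = j) \<longleftrightarrow> l = ?d + 2 * i" for l
      using parity[of l] eq by linarith
    then have "coeff (coeff (comb e k (\<lambda>j. coeff (coeff f (j div 2)) (k - j))) i) j
        = (\<Sum>l<Suc k. if l = ?d + 2 * i then ?f else 0)"
      unfolding rhs by (intro sum.cong refl) auto
    also have "\<dots> = ?f" using eq by (subst sum.delta) auto
    finally show ?thesis by simp
  qed
qed

section \<open>Homogeneity and the coordinates of block elements\<close>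

lemma homogeneous_scalar_add:
  "homogeneous_scalar d k f \<Longrightarrow> homogeneous_scalar d k g \<Longrightarrow> homogeneous_scalar d k (f + g)"
  unfolding homogeneous_scalar_def by (metis add.right_neutral coeff_add)

lemma homogeneous_scalar_minus: "homogeneous_scalar d k f \<Longrightarrow> homogeneous_scalar d k (- f)"
  unfolding homogeneous_scalar_def by simp

lemma homogeneous_scalar_0: "homogeneous_scalar d k 0"
  by (simp add: homogeneous_scalar_def)

text \<open>The variable \<open>s\<close> has \<open>x\<close>-degree 1, like \<open>w\<close> and
  \<open>yx\<close>, so trading \<open>w\<close> for \<open>s/2 - yx\<close> does not leave the
  block.\<close>

lemma homogeneous_scalar_half_s:
  assumes "homogeneous_scalar 1 k f"
  shows "homogeneous_scalar 0 k (half_s * f)"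
  unfolding homogeneous_scalar_def
proof (intro allI impI)
  fix a b
  assume nz: "coeff (coeff (half_s * f) a) b \<noteq> 0"
  have "coeff (coeff (half_s * f) a) b
      = smult (real_BB (1 / 2)) (case b of 0 \<Rightarrow> 0 | Suc b' \<Rightarrow> coeff (coeff f a) b')"
    unfolding half_s_def mult.assoc coeff_const_mult
    by (simp add: s_var_def coeff_pCons split: nat.split)
  then obtain b' where "b = Suc b'" "coeff (coeff f a) b' \<noteq> 0"
    using nz by (cases b) auto
  then show "0 + 2 * a + b = k"
    using assms unfolding homogeneous_scalar_def by fastforce
qed

lemma coords_H_block:
  assumes "F \<in> H_block k"
  obtains f0 f1 f2 f3 where "coords F = (f0, f1, f2, f3)"
    "homogeneous_scalar 0 k f0" "homogeneous_scalar 0 k f1"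
    "homogeneous_scalar 1 k f2" "homogeneous_scalar 1 k f3"
proof -
  obtain f0 f1 f2 f3 where F: "F = eval_scalar f0 + yv * eval_scalar f1 + xv * eval_scalar f2 + wv * eval_scalar f3"
    and "homogeneous_scalar 0 k f0" "homogeneous_scalar 0 k f1"
    "homogeneous_scalar 1 k f2" "homogeneous_scalar 1 k f3"
    using assms unfolding H_block_def by blast
  then show thesis
    by (intro that[of "f0 + half_s * f3" f1 f2 "- f3"] homogeneous_scalar_add
        homogeneous_scalar_half_s homogeneous_scalar_minus)
      (simp_all only:, simp add: coords_add coords_eval_scalar coords_basis_mult)
qed

lemma coords_inject: "coords F = coords G \<Longrightarrow> F = G"
  by (metis from_coords_coords)

lemma H_blockI:
  assumes F: "coords F = (f0, f1, f2, f3)"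
    and "homogeneous_scalar 0 k f0" "homogeneous_scalar 0 k f1"
    "homogeneous_scalar 1 k f2" "homogeneous_scalar 1 k f3"
  shows "F \<in> H_block k"
proof -
  have "F = eval_scalar (f0 + half_s * f3) + yv * eval_scalar f1 + xv * eval_scalar f2 + wv * eval_scalar (- f3)"
    by (rule coords_inject) (simp add: F coords_add coords_eval_scalar coords_basis_mult)
  moreover have "homogeneous_scalar 0 k (f0 + half_s * f3)" "homogeneous_scalar 1 k (- f3)"
    by (intro homogeneous_scalar_add homogeneous_scalar_half_s homogeneous_scalar_minus assms)+
  ultimately show ?thesis
    using assms unfolding H_block_def by blast
qed

lemma homogeneous_scalar_rs_monom: "d + 2 * a + b = k \<Longrightarrow> homogeneous_scalar d k (rs_monom a b)"
  by (simp add: homogeneous_scalar_def coeff_rs_monom)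

lemma block_basis_subset: "set (block_basis k) \<subseteq> H_block k"
proof -
  have "homogeneous_scalar (if even j then 0 else 1) k (rs_monom (j div 2) (k - j))" if "j < Suc k" for j
    using that by (intro homogeneous_scalar_rs_monom) (auto elim!: evenE oddE)
  then have "u_basis k j \<in> H_block k" "v_basis k j \<in> H_block k" if "j < Suc k" for j
    using that[THEN \<open>\<And>j. j < Suc k \<Longrightarrow> _\<close>]
    by (cases "even j"; auto intro!: H_blockI coords_u_basis[THEN trans] coords_v_basis[THEN trans] homogeneous_scalar_0)+
  then show ?thesis by (auto simp: block_basis_def simp del: upt_Suc)
qed

lemma is_basis_block_basis: "is_basis_over_t (H_block k) (block_basis k)"
  unfolding is_basis_over_t_def
proof (intro conjI block_basis_subset ballI)
  fix F assume "F \<in> H_block k"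
  then obtain f0 f1 f2 f3 where F: "coords F = (f0, f1, f2, f3)"
    and hom: "homogeneous_scalar 0 k f0" "homogeneous_scalar 0 k f1"
    "homogeneous_scalar 1 k f2" "homogeneous_scalar 1 k f3"
    by (rule coords_H_block)
  let ?n = "length (block_basis k)"
  define co :: "scalar \<Rightarrow> nat \<Rightarrow> BB poly" where "co f j = coeff (coeff f (j div 2)) (k - j)" for f j
  \<comment> \<open>The first \<open>Suc k\<close> entries belong to \<open>u_basis\<close>, with
    \<open>f0\<close> at even and \<open>f3\<close> at odd positions; the others belong to
    \<open>v_basis\<close>, with \<open>f1\<close> and \<open>f2\<close>.\<close>
  define c where "c = (\<lambda>j. if j < Suc k then co (if even j then f0 else f3) j
      else co (if even (j - Suc k) then f1 else f2) (j - Suc k))"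
  have comb_cong: "comb e k g = comb e k h" if "\<And>j. j < Suc k \<Longrightarrow> even j = e \<Longrightarrow> g j = h j" for e g h
    unfolding comb_def using that by (intro sum.cong refl) auto
  show "\<exists>!c. c \<in> carrier_vec ?n \<and> F = (\<Sum>i<?n. eval_t (c $ i) * block_basis k ! i)"
  proof (rule ex1I[of _ "vec ?n c"], intro conjI)
    show "vec ?n c \<in> carrier_vec ?n" by simp
    have "f0 = comb True k c"
      using homogeneous_scalar_eq_comb[of True k f0] hom by (simp add: c_def co_def cong: comb_cong)
    moreover have "f3 = comb False k c"
      using homogeneous_scalar_eq_comb[of False k f3] hom by (simp add: c_def co_def cong: comb_cong)
    moreover have "f1 = comb True k (\<lambda>j. c (Suc k + j))"
      using homogeneous_scalar_eq_comb[of True k f1] hom by (simp add: c_def co_def cong: comb_cong)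
    moreover have "f2 = comb False k (\<lambda>j. c (Suc k + j))"
      using homogeneous_scalar_eq_comb[of False k f2] hom by (simp add: c_def co_def cong: comb_cong)
    ultimately have "coords F = coords (\<Sum>i<?n. eval_t (c i) * block_basis k ! i)"
      unfolding coords_sum_block_basis F by simp
    then show "F = (\<Sum>i<?n. eval_t (vec ?n c $ i) * block_basis k ! i)"
      by (intro coords_inject) simp
  next
    fix c' assume c': "c' \<in> carrier_vec ?n \<and> F = (\<Sum>i<?n. eval_t (c' $ i) * block_basis k ! i)"
    then have "coords F = coords (\<Sum>i<?n. eval_t (c' $ i) * block_basis k ! i)" by simp
    then have eqs: "f0 = comb True k (($) c')" "f1 = comb True k (\<lambda>j. c' $ (Suc k + j))"
      "f2 = comb False k (\<lambda>j. c' $ (Suc k + j))" "f3 = comb False k (($) c')"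
      unfolding coords_sum_block_basis F by simp_all
    show "c' = vec ?n c"
    proof (rule eq_vecI)
      fix j assume "j < dim_vec (vec ?n c)"
      then have j: "j < Suc k + Suc k" by (simp add: length_block_basis)
      have "c j = c' $ j"
      proof (cases "j < Suc k")
        case True
        then show ?thesis by (simp add: c_def co_def eqs coeff_comb)
      next
        case False
        then obtain l where l: "j = Suc k + l" using le_Suc_ex not_less by blast
        then have "l \<le> k" using j by simp
        then show ?thesis by (simp add: l c_def co_def eqs coeff_comb)
      qed
      then show "c' $ j = vec ?n c $ j" using j by (simp add: length_block_basis)
    qed (use c' in auto)
  qed
qed

lemma zero_in_H_block: "0 \<in> H_block k"
  by (rule H_blockI[of 0 0 0 0 0]) (auto simp: coords_0 homogeneous_scalar_0 zero_prod_def)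

section \<open>The operator in the basis\<close>

definition u_diag :: "nat \<Rightarrow> nat \<Rightarrow> BB" where
  "u_diag k j = (if even j then A_fac k (j div 2) else qnum (int j + 1))"

definition u_sub :: "nat \<Rightarrow> nat \<Rightarrow> BB poly" where
  "u_sub k j = (if even j then [:- 2 * Q_BB * qpow (int j) * qnum (int (k - j)):]
     else [:0, 2 * qpow (int j + 1) * qnum (int (k - j)):])"

definition v_diag :: "nat \<Rightarrow> nat \<Rightarrow> BB" where
  "v_diag k j = (if even j then qpow (int j) * qnum (int (Suc (k - j))) + qnum_m (- 1)
       + Q_BB * qpow (- 1) * qnum (int k) else qnum (int j + 1))"

definition v_sub :: "nat \<Rightarrow> nat \<Rightarrow> BB poly" where
  "v_sub k j = (if even j then [:0, - 2 * Q_BB * qpow (- 1) * qpow (int j) * qnum (int (k - j)):]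
     else [:2 * qpow (int j + 1) * qnum (int (k - j)):])"

text \<open>The superdiagonal entry of an even column divided by the diagonal entry
  \<open>[j]\<close> of the odd column before it. The quotient lies in the coefficient ring, so
  \<open>v_super\<close> can be defined as the product.\<close>

definition v_mult :: "nat \<Rightarrow> BB" where
  "v_mult j = (if even j \<and> j \<noteq> 0 then real_BB (1 / 2) * (1 - Q_BB * qpow (- 1)) else 0)"

definition v_super :: "nat \<Rightarrow> BB" where
  "v_super j = v_mult j * qnum (int j)"

lemma coords_d_sc_rs_monom:
  "coords (d_sc (rs_monom a b)) =
     (0, 2 * const_scalar (qpow (2 * int a) * qnum (int b)) * rs_monom a (b - 1),
      const_scalar (qnum (2 * int a)) * rs_monom (a - 1) b, 0)"
proof -
  have "2 * yv * F = yv * F + yv * F" for F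
    by (simp add: mult_2 distrib_right)
  then show ?thesis
    unfolding d_sc_rs_monom by (simp add: coords_add coords_basis_mult algebra_simps)
qed

text \<open>At \<open>a = 0\<close> the truncated exponent breaks \<open>r * r^(a-1) = r^a\<close>,
  but \<open>[0] = 0\<close> annihilates both sides. The variable \<open>s\<close> is treated
  analogously.\<close>

lemma r_var_rs_monom_pred:
  "r_var * (const_scalar (qnum (2 * int a)) * rs_monom (a - 1) b) = const_scalar (qnum (2 * int a)) * rs_monom a b"
proof (cases a)
  case (Suc a')
  then show ?thesis by (simp only: mult.left_commute[of r_var]) (simp add: r_var_rs_monom)
qed (simp add: const_scalar_simps)

lemma s_var_rs_monom_pred:
  "s_var * (const_scalar (c * qnum (int b)) * rs_monom a (b - 1)) = const_scalar (c * qnum (int b)) * rs_monom a b"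
proof (cases b)
  case (Suc b')
  then show ?thesis by (simp only: mult.left_commute[of s_var]) (simp add: s_var_rs_monom)
qed (simp add: const_scalar_simps)

lemma const_t: "[:[:[:c:]:]:] = const_scalar c" "[:[:[:0, c:]:]:] = const_scalar c * t_var"
  by (simp_all add: const_scalar_def t_var_def)

lemma const_scalar_diff: "const_scalar (a - b) = const_scalar a - const_scalar b"
  by (simp add: const_scalar_def)

lemma const_scalar_minus: "const_scalar (- a) = - const_scalar a"
  by (simp add: const_scalar_def)

lemma const_scalar_2: "const_scalar 2 = 2"
  using const_scalar_simps(3)[of 1 1] by (simp add: const_scalar_simps(2))

lemma const_scalar_half: "2 * const_scalar (real_BB (1 / 2)) = 1"
  by (simp add: two_times_half const_scalar_simps flip: const_scalar_2 const_scalar_simps(4))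

text \<open>In \<open>Q x d_sc (r^a s^b)\<close> the product \<open>x y\<close> is reordered to
  \<open>s - yx\<close>. The part \<open>s\<close> joins \<open>[m]\<close> and
  \<open>Q [2a]\<close> in the diagonal entry \<open>A_fac\<close>, and the part \<open>- yx\<close>
  gives the subdiagonal one.\<close>

lemma K_op_u_basis_even:
  assumes j: "even j" "j \<le> k"
  shows "K_op (u_basis k j) = eval_t [:u_diag k j:] * u_basis k j + eval_t (u_sub k j) * u_basis k (Suc j)"
proof (rule coords_inject)
  define a where "a = j div 2"
  define b where "b = k - j"
  have ja: "j = 2 * a" and kb: "int k - 2 * int a = int b"
    using j by (auto simp: a_def b_def)
  let ?X = "rs_monom a b" and ?Y = "rs_monom a (b - 1)"
  let ?c = "qpow (2 * int a) * qnum (int b)"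
  have u: "coords (u_basis k j) = (?X, 0, 0, 0)" "coords (u_basis k (Suc j)) = (0, 0, 0, ?Y)"
    using j by (simp_all add: coords_u_basis a_def b_def)
  have rX: "r_var * (const_scalar (qnum (2 * int a)) * rs_monom (a - Suc 0) b)
      = const_scalar (qnum (2 * int a)) * ?X"
    using r_var_rs_monom_pred[of a b] by simp
  have sX: "s_var * (2 * (const_scalar ?c * rs_monom a (b - Suc 0))) = 2 * (const_scalar ?c * ?X)"
    using s_var_rs_monom_pred[of "qpow (2 * int a)" b a] by (simp only: mult.left_commute[of s_var 2]) simp
  have "coords (K_op (u_basis k j)) = (const_scalar (qnum_m 0) * ?X
      + const_scalar Q_BB * (2 * const_scalar ?c * ?X + const_scalar (qnum (2 * int a)) * ?X), 0, 0,
      - (const_scalar Q_BB * (2 * const_scalar ?c * ?Y)))"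
    unfolding K_op_eq[OF u(1)]
    by (simp add: rX sX distrib_left d_sc_0 eval_scalar_0 coords_add coords_const_mult coords_eval_scalar mult.assoc
        coords_xv_mult coords_d_sc_rs_monom)
  also have "\<dots> = coords (eval_t [:u_diag k j:] * u_basis k j + eval_t (u_sub k j) * u_basis k (Suc j))"
  proof -
    have "u_diag k j = qnum_m 0 + Q_BB * (qnum (2 * int a) + 2 * qpow (2 * int a) * qnum (int b))"
      "u_sub k j = [:- 2 * Q_BB * qpow (2 * int a) * qnum (int b):]"
      using j by (simp_all add: u_diag_def u_sub_def A_fac_def ja flip: kb)
    then show ?thesis
      unfolding coords_add coords_eval_t_mult u
      by (simp add: const_t const_scalar_simps const_scalar_2 const_scalar_minus algebra_simps)
  qed
  finally show "coords (K_op (u_basis k j))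
    = coords (eval_t [:u_diag k j:] * u_basis k j + eval_t (u_sub k j) * u_basis k (Suc j))" .
qed

text \<open>As \<open>yx * x = r y\<close>, only \<open>y d_sc (r^(a+1) s^b)\<close> arises: its
  \<open>x\<close> part returns the basis vector with \<open>[2a+2]\<close>, and
  \<open>y^2 = t\<close> accounts for the factor \<open>t\<close> below the diagonal.\<close>

lemma K_op_u_basis_odd:
  assumes j: "odd j" "j \<le> k"
  shows "K_op (u_basis k j) = eval_t [:u_diag k j:] * u_basis k j + eval_t (u_sub k j) * u_basis k (Suc j)"
proof (rule coords_inject)
  define a where "a = j div 2"
  define b where "b = k - j"
  have "j = Suc (2 * a)"
    using j by (simp add: a_def)
  then have ja: "int j + 1 = 2 * int (Suc a)"
    by simp
  let ?X = "rs_monom a b" and ?Y = "rs_monom (Suc a) (b - 1)"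
  let ?c = "qpow (2 * int (Suc a)) * qnum (int b)"
  have u: "coords (u_basis k j) = (0, 0, 0, ?X)" "coords (u_basis k (Suc j)) = (?Y, 0, 0, 0)"
    using j by (simp_all add: coords_u_basis a_def b_def)
  have "coords (K_op (u_basis k j)) = (t_var * (2 * const_scalar ?c * ?Y), 0, 0,
      const_scalar (qnum (2 * int (Suc a))) * ?X)"
    unfolding K_op_eq[OF u(1)]
    by (simp add: d_sc_0 eval_scalar_0 coords_add coords_yv_mult r_var_rs_monom coords_d_sc_rs_monom coords_0 zero_prod_def)
  also have "\<dots> = coords (eval_t [:u_diag k j:] * u_basis k j + eval_t (u_sub k j) * u_basis k (Suc j))"
    using j unfolding coords_add coords_eval_t_mult u u_diag_def u_sub_def ja
    by (simp add: const_t const_scalar_simps const_scalar_2 algebra_simps flip: b_def)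
  finally show "coords (K_op (u_basis k j))
    = coords (eval_t [:u_diag k j:] * u_basis k j + eval_t (u_sub k j) * u_basis k (Suc j))" .
qed

text \<open>As \<open>x * x = r\<close>, the image is \<open>d_sc (r^(a+1) s^b)\<close>, both of
  whose terms are multiples of basis vectors already.\<close>

lemma K_op_v_basis_odd:
  assumes j: "odd j" "j \<le> k"
  shows "K_op (v_basis k j) = eval_t [:v_super j:] * v_basis k (j - 1) + eval_t [:v_diag k j:] * v_basis k j
      + eval_t (v_sub k j) * v_basis k (Suc j)"
proof (rule coords_inject)
  define a where "a = j div 2"
  define b where "b = k - j"
  have "j = Suc (2 * a)"
    using j by (simp add: a_def)
  then have ja: "int j + 1 = 2 * int (Suc a)"
    by simp
  let ?X = "rs_monom a b" and ?Y = "rs_monom (Suc a) (b - 1)"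
  let ?c = "qpow (2 * int (Suc a)) * qnum (int b)"
  have v: "coords (v_basis k j) = (0, 0, ?X, 0)" "coords (v_basis k (Suc j)) = (0, ?Y, 0, 0)"
    using j by (simp_all add: coords_v_basis a_def b_def)
  have sup: "v_super j = 0" using j by (simp add: v_super_def v_mult_def)
  have "coords (K_op (v_basis k j)) = (0, 2 * const_scalar ?c * ?Y,
      const_scalar (qnum (2 * int (Suc a))) * ?X, 0)"
    unfolding K_op_eq[OF v(1)]
    by (simp add: d_sc_0 eval_scalar_0 coords_add r_var_rs_monom coords_d_sc_rs_monom coords_0 zero_prod_def)
  also have "\<dots> = coords (eval_t [:v_super j:] * v_basis k (j - 1) + eval_t [:v_diag k j:] * v_basis k j
      + eval_t (v_sub k j) * v_basis k (Suc j))"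
    using j unfolding sup coords_add coords_eval_t_mult v v_diag_def v_sub_def ja
    by (simp add: const_t const_scalar_simps const_scalar_2 algebra_simps zero_prod_def flip: b_def)
  finally show "coords (K_op (v_basis k j)) = coords (eval_t [:v_super j:] * v_basis k (j - 1)
      + eval_t [:v_diag k j:] * v_basis k j + eval_t (v_sub k j) * v_basis k (Suc j))" .
qed

text \<open>Besides \<open>d_sc\<close> of \<open>(s/2) r^a s^b\<close>, the products
  \<open>w x = (s/2) x - r y\<close> and \<open>w y = t x - (s/2) y\<close> enter. The terms in
  \<open>x r^(a-1) s^(b+1)\<close> combine to the factor \<open>(1 - Q/q)/2\<close> above the
  diagonal.\<close>

lemma K_op_v_basis_even:
  assumes j: "even j" "j \<le> k"
  shows "K_op (v_basis k j) = eval_t [:v_super j:] * v_basis k (j - 1) + eval_t [:v_diag k j:] * v_basis k j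
      + eval_t (v_sub k j) * v_basis k (Suc j)"
proof (rule coords_inject)
  define a where "a = j div 2"
  define b where "b = k - j"
  have ja: "j = 2 * a" and kb: "k = 2 * a + b"
    using j by (auto simp: a_def b_def)
  let ?X = "rs_monom a b" and ?Y = "rs_monom a (b - 1)" and ?Z = "rs_monom (a - 1) (Suc b)"
  let ?h = "const_scalar (real_BB (1 / 2))"
  let ?Qq = "const_scalar (Q_BB * qpow (- 1))"
  let ?c = "const_scalar (qpow (2 * int a))"
  have v: "coords (v_basis k j) = (0, ?X, 0, 0)" "coords (v_basis k (Suc j)) = (0, 0, ?Y, 0)"
    using j by (simp_all add: coords_v_basis a_def b_def)
  have half_X: "half_s * ?X = ?h * rs_monom a (Suc b)"
    by (simp add: half_s_def mult.assoc s_var_rs_monom)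
  \<comment> \<open>At \<open>a = 0\<close> the truncated \<open>j - 1\<close> is \<open>j\<close>
    itself, and \<open>[0] = 0\<close> removes the term.\<close>
  have super: "coords (eval_t [:v_super j:] * v_basis k (j - 1))
     = (0, 0, ?h * (1 - ?Qq) * const_scalar (qnum (2 * int a)) * ?Z, 0)"
  proof (cases a)
    case 0
    then show ?thesis
      by (cases "coords (v_basis k 0)")
       (simp add: v_super_def ja const_scalar_simps coords_eval_t_mult)
  next
    case (Suc a')
    then have "coords (v_basis k (j - 1)) = (0, 0, ?Z, 0)"
      by (simp add: coords_v_basis ja kb)
    then show ?thesis
      using Suc by (simp add: coords_eval_t_mult v_super_def v_mult_def ja const_t const_scalar_simps
          const_scalar_diff)
  qed
  have sY: "s_var * (?c * (const_scalar (qnum (int b)) * ?Y)) = ?c * (const_scalar (qnum (int b)) * ?X)"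
    using s_var_rs_monom_pred[of "qpow (2 * int a)" b a] by (simp add: const_scalar_simps mult.assoc)
  have rZ: "r_var * (const_scalar (qnum (2 * int a)) * rs_monom (a - 1) b) = const_scalar (qnum (2 * int a)) * ?X"
    by (rule r_var_rs_monom_pred)
  have sZ: "s_var * rs_monom (a - 1) b = ?Z" by (rule s_var_rs_monom)
  \<comment> \<open>The \<open>y\<close> parts of \<open>w x\<close> and \<open>w y\<close>
    contribute \<open>[2a]\<close> and \<open>q^(2a) [b]\<close>, which add up to \<open>[k]\<close>
    in the diagonal entry.\<close>
  have qk: "const_scalar (qnum (int k)) = const_scalar (qnum (2 * int a)) + ?c * const_scalar (qnum (int b))"
    by (simp add: kb qnum_add const_scalar_simps)
  let ?V1 = "2 * (?c * (const_scalar (qnum (int b)) * ?Y))"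
  let ?V2 = "const_scalar (qnum (2 * int a)) * rs_monom (a - 1) b"
  have "coords (K_op (v_basis k j)) = (0,
      ?h * (2 * ?c * const_scalar (qnum (int (Suc b))) * ?X) + const_scalar (qnum_m (- 1)) * ?X
        - ?Qq * (?h * (s_var * ?V1) - s_var * ?V1 - r_var * ?V2),
      ?h * (const_scalar (qnum (2 * int a)) * ?Z) - ?Qq * (?h * (s_var * ?V2) + t_var * ?V1), 0)"
    unfolding K_op_eq[OF v(1)] half_X
    by (simp add: d_sc_0 d_sc_const eval_scalar_0 coords_add coords_diff coords_const_mult
        coords_yv_mult coords_wv_mult coords_eval_scalar coords_d_sc_rs_monom mult.assoc half_s_def
        const_scalar_simps coords_0 zero_prod_def)
  also have "s_var * ?V1 = 2 * (?c * (const_scalar (qnum (int b)) * ?X))"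
    using sY by (simp add: mult.left_commute[of s_var 2])
  also have "s_var * ?V2 = const_scalar (qnum (2 * int a)) * ?Z"
    by (simp only: mult.left_commute[of s_var] sZ)
  also have "((0,
      ?h * (2 * ?c * const_scalar (qnum (int (Suc b))) * ?X) + const_scalar (qnum_m (- 1)) * ?X
        - ?Qq * (?h * (2 * (?c * (const_scalar (qnum (int b)) * ?X))) - 2 * (?c * (const_scalar (qnum (int b)) * ?X)) - r_var * ?V2),
      ?h * (const_scalar (qnum (2 * int a)) * ?Z) - ?Qq * (?h * (const_scalar (qnum (2 * int a)) * ?Z) + t_var * ?V1), 0) :: quad)
     = (0, 0, ?h * (1 - ?Qq) * const_scalar (qnum (2 * int a)) * ?Z, 0) +
       (0, const_scalar (v_diag k j) * ?X, const_scalar (- 2 * Q_BB * qpow (- 1) * qpow (int j) * qnum (int (k - j))) * t_var * ?Y, 0)"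
  proof -
    have h: "?h * (2 * F) = F" for F
      using const_scalar_half by (metis mult.assoc mult.commute mult.left_neutral)
    have "const_scalar (v_diag k j) = ?c * const_scalar (qnum (int (Suc b))) + const_scalar (qnum_m (- 1))
       + ?Qq * const_scalar (qnum (int k))"
      using j by (simp add: v_diag_def ja kb const_scalar_simps)
    then show ?thesis
      unfolding h rZ qk
      using h[of "?c * (const_scalar (qnum (int (Suc b))) * ?X)"]
      by (simp add: ja kb const_scalar_simps const_scalar_2 const_scalar_minus algebra_simps)
  qed
  also have "\<dots> = coords (eval_t [:v_super j:] * v_basis k (j - 1) + eval_t [:v_diag k j:] * v_basis k j
      + eval_t (v_sub k j) * v_basis k (Suc j))"
    unfolding coords_add super using j by (simp add: coords_eval_t_mult v v_sub_def const_t)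
  finally show "coords (K_op (v_basis k j)) = coords (eval_t [:v_super j:] * v_basis k (j - 1)
      + eval_t [:v_diag k j:] * v_basis k j + eval_t (v_sub k j) * v_basis k (Suc j))" .
qed

section \<open>The determinant\<close>

lemma sum_tridiagonal:
  fixes j n :: nat
  assumes "j < n"
  shows "(\<Sum>i<n. eval_t (if i = j then d else if i = Suc j then l else if j = Suc i then u else 0) * b i)
    = (if j = 0 then 0 else eval_t u * b (j - 1)) + eval_t d * b j
      + (if Suc j < n then eval_t l * b (Suc j) else 0)"
proof -
  have "(\<Sum>i<n. eval_t (if i = j then d else if i = Suc j then l else if j = Suc i then u else 0) * b i)
    = (\<Sum>i<n. (if i = j - 1 then if j = 0 then 0 else eval_t u * b i else 0)
        + (if i = j then eval_t d * b i else 0) + (if i = Suc j then eval_t l * b i else 0))"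
    by (intro sum.cong refl) (auto simp: eval_t_0)
  also have "\<dots> = (if j = 0 then 0 else eval_t u * b (j - 1)) + eval_t d * b j
      + (if Suc j < n then eval_t l * b (Suc j) else 0)"
    using assms unfolding sum.distrib by (simp add: less_imp_diff_less)
  finally show ?thesis .
qed

definition append_fun :: "nat \<Rightarrow> (nat \<Rightarrow> 'a) \<Rightarrow> (nat \<Rightarrow> 'a) \<Rightarrow> nat \<Rightarrow> 'a" where
  "append_fun n f g j = (if j < n then f j else g (j - n))"

text \<open>Both families share one tridiagonal matrix. The two entries that could link them, at
  positions \<open>(Suc k, k)\<close> and \<open>(k, Suc k)\<close>, vanish because
  \<open>u_sub k k = 0\<close> and \<open>v_super 0 = 0\<close>.\<close>

definition K_matrix :: "nat \<Rightarrow> BB poly mat" where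
  "K_matrix k = mat (Suc k + Suc k) (Suc k + Suc k) (\<lambda>(i, j).
     if i = j then append_fun (Suc k) (\<lambda>j. [:u_diag k j:]) (\<lambda>j. [:v_diag k j:]) j
     else if i = Suc j then append_fun (Suc k) (u_sub k) (v_sub k) j
     else if j = Suc i then append_fun (Suc k) (\<lambda>_. 0) (\<lambda>j. [:v_super j:]) j
     else 0)"

lemma is_matrix_K_matrix: "is_matrix_over_t K_op (block_basis k) (K_matrix k)"
  unfolding is_matrix_over_t_def
proof (intro conjI allI impI)
  show "K_matrix k \<in> carrier_mat (length (block_basis k)) (length (block_basis k))"
    by (simp add: K_matrix_def length_block_basis)
  fix j assume "j < length (block_basis k)"
  then have j: "j < Suc k + Suc k" by (simp add: length_block_basis)
  let ?b = "(!) (block_basis k)"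
  let ?d = "append_fun (Suc k) (\<lambda>j. [:u_diag k j:]) (\<lambda>j. [:v_diag k j:]) j"
  let ?l = "append_fun (Suc k) (u_sub k) (v_sub k) j"
  let ?u = "append_fun (Suc k) (\<lambda>_. 0) (\<lambda>j. [:v_super j:]) j"
  have "(\<Sum>i<length (block_basis k). eval_t (K_matrix k $$ (i, j)) * ?b i)
      = (\<Sum>i<Suc k + Suc k. eval_t (if i = j then ?d else if i = Suc j then ?l else if j = Suc i then ?u else 0) * ?b i)"
    unfolding length_block_basis using j by (intro sum.cong refl) (simp add: K_matrix_def)
  also have "\<dots> = (if j = 0 then 0 else eval_t ?u * ?b (j - 1)) + eval_t ?d * ?b j
      + (if Suc j < Suc k + Suc k then eval_t ?l * ?b (Suc j) else 0)"
    by (rule sum_tridiagonal[OF j])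
  also have "\<dots> = K_op (?b j)"
  proof (cases "j < Suc k")
    case True
    have "K_op (u_basis k j) = eval_t [:u_diag k j:] * u_basis k j + eval_t (u_sub k j) * u_basis k (Suc j)"
      using K_op_u_basis_even[of j k] K_op_u_basis_odd[of j k] True by (cases "even j") auto
    \<comment> \<open>At \<open>j = k\<close> the next basis element is \<open>v_basis k 0\<close>
      and not \<open>u_basis k (Suc k)\<close>; the coefficient 0 reconciles the two sides.\<close>
    moreover have "eval_t (u_sub k j) * u_basis k (Suc j) = eval_t (u_sub k j) * ?b (Suc j)"
    proof (cases "j = k")
      case True
      then have "u_sub k j = 0" by (simp add: u_sub_def)
      then show ?thesis by (simp add: eval_t_0)
    next
      case False
      then show ?thesis using \<open>j < Suc k\<close> by (simp add: nth_block_basis)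
    qed
    ultimately show ?thesis
      using True by (simp add: append_fun_def nth_block_basis eval_t_0)
  next
    case False
    then obtain l where l: "j = Suc k + l" using le_Suc_ex not_less by blast
    then have "l \<le> k" using j by simp
    have nth: "?b (Suc k + i) = v_basis k i" if "i \<le> k" for i
      using that by (simp only: nth_block_basis less_Suc_eq_le)
    have "K_op (v_basis k l) = eval_t [:v_super l:] * v_basis k (l - 1) + eval_t [:v_diag k l:] * v_basis k l
        + eval_t (v_sub k l) * v_basis k (Suc l)"
      using K_op_v_basis_even[of l k] K_op_v_basis_odd[of l k] \<open>l \<le> k\<close> by (cases "even l") auto
    moreover have "eval_t [:v_super l:] * v_basis k (l - 1) = eval_t [:v_super l:] * ?b (Suc k + l - 1)"
    proof (cases l)
      case 0
      then show ?thesis by (simp add: v_super_def eval_t_0)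
    next
      case (Suc i)
      then show ?thesis using nth[of i] \<open>l \<le> k\<close> by simp
    qed
    moreover have "eval_t (v_sub k l) * v_basis k (Suc l)
        = (if Suc j < Suc k + Suc k then eval_t (v_sub k l) * ?b (Suc k + Suc l) else 0)"
    proof (cases "l = k")
      case True
      then have "v_sub k l = 0" by (simp add: v_sub_def)
      then show ?thesis by (simp add: eval_t_0)
    next
      case False
      then show ?thesis using nth[of "Suc l"] \<open>l \<le> k\<close> l by simp
    qed
    ultimately show ?thesis
      using nth[of l] \<open>l \<le> k\<close> by (simp add: l append_fun_def)
  qed
  finally show "K_op (?b j) = (\<Sum>i<length (block_basis k). eval_t (K_matrix k $$ (i, j)) * ?b i)" ..
qed

section \<open>Pivots after elimination and their product\<close>

definition v_pivot :: "nat \<Rightarrow> nat \<Rightarrow> BB" where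
  "v_pivot k j = (if j = 0 then C_fac k else if even j then B_fac k (j div 2 - 1) else qnum (int j + 1))"

text \<open>With \<open>j = 2a + 2\<close> and \<open>p = q^(2a+2) [k-1-2a]\<close>, the diagonal
  entry \<open>p + [m-1] + (Q/q) [k]\<close> loses \<open>v_mult j * 2p = (1 - Q/q) p\<close>, which
  leaves \<open>B_fac k a\<close>. At \<open>j = 0\<close> the diagonal entry is
  \<open>C_fac k\<close> already.\<close>

lemma v_pivot_eq:
  assumes "j \<le> k"
  shows "[:v_diag k j:] - [:v_mult j:] * v_sub k (j - 1) = [:v_pivot k j:]"
proof (cases "even j \<and> j \<noteq> 0")
  case False
  then show ?thesis
    by (auto simp: v_mult_def v_diag_def v_pivot_def C_fac_def algebra_simps)
next
  case True
  then obtain b where "j = 2 * b" "b \<noteq> 0" by (auto elim: evenE)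
  then obtain a where a: "j = Suc (Suc (2 * a))" by (cases b) auto
  let ?p = "qpow (2 * int a + 2) * qnum (int k - 1 - 2 * int a)" and ?Qq = "Q_BB * qpow (- 1)"
  have eqs: "int j = 2 * int a + 2" "int (j - 1) + 1 = 2 * int a + 2"
    "int (Suc (k - j)) = int k - 1 - 2 * int a" "int (k - (j - 1)) = int k - 1 - 2 * int a"
    using assms a by auto
  have "v_diag k j = ?p + qnum_m (- 1) + ?Qq * qnum (int k)"
    using True unfolding v_diag_def eqs by simp
  moreover have "odd (j - 1)" using a by simp
  then have "v_sub k (j - 1) = [:2 * ?p:]"
    unfolding v_sub_def eqs by (simp add: mult.assoc)
  moreover have "v_mult j * (2 * ?p) = (1 - ?Qq) * ?p"
  proof -
    have "v_mult j * (2 * ?p) = (2 * real_BB (1 / 2)) * ((1 - ?Qq) * ?p)"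
      using True by (simp add: v_mult_def algebra_simps)
    then show ?thesis by (simp add: two_times_half)
  qed
  moreover have "v_pivot k j = qnum_m (- 1) + ?Qq * (qnum (int k) + ?p)"
    by (simp add: v_pivot_def a B_fac_def)
  ultimately show ?thesis
    by (simp add: algebra_simps)
qed

lemma prod_const_poly:
  fixes f :: "nat \<Rightarrow> 'a::comm_ring_1"
  shows "(\<Prod>j<n. [:f j:]) = [:\<Prod>j<n. f j:]"
  by (induction n) (simp_all add: one_pCons mult.commute)

lemma det_K_matrix:
  "det (K_matrix k) = [:(\<Prod>j<Suc k. u_diag k j) * (\<Prod>j<Suc k. v_pivot k j):]"
proof -
  let ?n = "Suc k"
  let ?d = "append_fun ?n (\<lambda>j. [:u_diag k j:]) (\<lambda>j. [:v_diag k j:])"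
  let ?l = "append_fun ?n (u_sub k) (v_sub k)"
  let ?u = "append_fun ?n (\<lambda>_. 0) (\<lambda>j. [:v_super j:])"
  let ?c = "append_fun ?n (\<lambda>_. 0) (\<lambda>j. [:v_mult j:])"
  have "det (K_matrix k) = (\<Prod>j<?n + ?n. ?d j - ?c j * ?l (j - 1))"
  proof (rule det_tridiagonal[OF K_matrix_def])
    fix j assume j: "Suc j < ?n + ?n"
    \<comment> \<open>Column \<open>Suc j\<close> lies in the first family, opens the second, or
      comes later. In the first two cases both sides are 0. In the third,
      \<open>v_super (Suc i) = v_mult (Suc i) * [i+1]\<close>, where \<open>[i+1]\<close> is
      \<open>v_diag k i\<close> for odd \<open>i\<close> and \<open>v_mult (Suc i) = 0\<close> for
      even \<open>i\<close>.\<close>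
    consider "Suc j < ?n" | "Suc j = ?n" | i where "j = ?n + i"
    proof (cases "j < ?n")
      case True
      then show thesis using that(1,2) by linarith
    next
      case False
      then show thesis using that(3)[of "j - ?n"] by simp
    qed
    then show "?u (Suc j) = ?c (Suc j) * ?d j"
    proof cases
      case 1
      then show ?thesis by (simp add: append_fun_def)
    next
      case 2
      then show ?thesis by (simp add: append_fun_def v_super_def v_mult_def)
    next
      case 3
      then show ?thesis by (simp add: append_fun_def v_super_def v_mult_def v_diag_def add.commute)
    qed
    \<comment> \<open>Of two consecutive indices one is odd, and there \<open>v_mult\<close>, and
      with it \<open>v_super\<close>, vanishes.\<close>
    show "?c (Suc j) * ?u j = 0"
      by (auto simp: append_fun_def v_super_def v_mult_def Suc_diff_le)
  qed (simp add: append_fun_def)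
  also have "\<dots> = (\<Prod>j<?n. ?d j - ?c j * ?l (j - 1)) * (\<Prod>j<?n. ?d (?n + j) - ?c (?n + j) * ?l (?n + j - 1))"
    by (rule prod_lessThan_add)
  also have "(\<Prod>j<?n. ?d j - ?c j * ?l (j - 1)) = (\<Prod>j<?n. [:u_diag k j:])"
    by (intro prod.cong refl) (simp add: append_fun_def)
  also have "(\<Prod>j<?n. ?d (?n + j) - ?c (?n + j) * ?l (?n + j - 1)) = (\<Prod>j<?n. [:v_pivot k j:])"
  proof (intro prod.cong refl)
    fix j assume "j \<in> {..<?n}"
    then have "[:v_diag k j:] - [:v_mult j:] * v_sub k (j - 1) = [:v_pivot k j:]"
      by (intro v_pivot_eq) simp
    \<comment> \<open>For \<open>j = 0\<close> the index \<open>?n + j - 1\<close> falls into the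
      first family; \<open>v_mult 0 = 0\<close> makes both sides vanish.\<close>
    moreover have "?c (?n + j) * ?l (?n + j - 1) = [:v_mult j:] * v_sub k (j - 1)"
      by (cases j) (auto simp: append_fun_def v_mult_def)
    ultimately show "?d (?n + j) - ?c (?n + j) * ?l (?n + j - 1) = [:v_pivot k j:]"
      by (simp add: append_fun_def)
  qed
  finally show ?thesis
    by (simp add: prod_const_poly del: prod.lessThan_Suc)
qed

lemma D_det_eq: "D_det k = [:(\<Prod>j<Suc k. u_diag k j) * (\<Prod>j<Suc k. v_pivot k j):]"
  unfolding D_det_def det_K_matrix[symmetric]
  by (rule det_over_t_eqI[OF zero_in_H_block K_op_add K_op_t_linear is_basis_block_basis is_matrix_K_matrix])

lemma prod_lessThan_double:
  fixes f :: "nat \<Rightarrow> 'a::comm_monoid_mult"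
  shows "(\<Prod>j<2 * n. f j) = (\<Prod>a<n. f (2 * a) * f (Suc (2 * a)))"
  by (induction n) (simp_all add: mult.assoc)

theorem theorem6p1:
  fixes k :: nat
  shows
    "(even k \<longrightarrow> D_det k =
        [: (qnum_m 0 + Q_BB * qnum (int k)) * C_fac k
           * (\<Prod>a<k div 2. qnum (2 * int a + 2) * A_fac k a)
           * (\<Prod>a<k div 2. qnum (2 * int a + 2) * B_fac k a) :])
     \<and>
     (odd k \<longrightarrow> D_det k =
        [: qnum (int k + 1) * C_fac k
           * (\<Prod>a<(k + 1) div 2. qnum (2 * int a + 2) * A_fac k a)
           * (\<Prod>a<(k - 1) div 2. qnum (2 * int a + 2) * B_fac k a) :])"
proof -
  have index: "int (Suc (2 * a)) + 1 = 2 * int a + 2" for a by simp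
  \<comment> \<open>Indices \<open>2a\<close> and \<open>2a + 1\<close> are paired, with pivots
    \<open>A_fac k a\<close> and \<open>[2a+2]\<close>.\<close>
  have u: "(\<Prod>j<2 * n. u_diag k j) = (\<Prod>a<n. qnum (2 * int a + 2) * A_fac k a)" for n
    unfolding prod_lessThan_double
    by (intro prod.cong refl) (simp only: u_diag_def index, simp add: mult.commute)
  \<comment> \<open>The pairing is shifted by one, because index 0 carries \<open>C_fac k\<close>:
    indices \<open>2a + 1\<close> and \<open>2a + 2\<close> have pivots \<open>[2a+2]\<close> and
    \<open>B_fac k a\<close>.\<close>
  have v: "(\<Prod>j<2 * n. v_pivot k (Suc j)) = (\<Prod>a<n. qnum (2 * int a + 2) * B_fac k a)" for n
    unfolding prod_lessThan_double
    by (intro prod.cong refl) (simp only: v_pivot_def index, simp)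
  have v0: "(\<Prod>j<Suc m. v_pivot k j) = C_fac k * (\<Prod>j<m. v_pivot k (Suc j))" for m
    unfolding prod.lessThan_Suc_shift by (simp add: v_pivot_def)
  show ?thesis
  proof (intro conjI impI)
    assume "even k"
    then obtain n where n: "k = 2 * n" by (elim evenE)
    \<comment> \<open>For even \<open>k\<close> the first family has the unpaired last index
      \<open>k = 2n\<close>; there \<open>[k - 2n] = 0\<close>, so \<open>A_fac k n\<close> reduces
      to the leading factor.\<close>
    have "(\<Prod>j<Suc k. u_diag k j) = (\<Prod>a<n. qnum (2 * int a + 2) * A_fac k a) * A_fac k n"
      using u[of n] by (simp add: n u_diag_def)
    moreover have "A_fac k n = qnum_m 0 + Q_BB * qnum (int k)"
      by (simp add: A_fac_def n)
    moreover have "(\<Prod>j<Suc k. v_pivot k j) = C_fac k * (\<Prod>a<n. qnum (2 * int a + 2) * B_fac k a)"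
      using v0[of k] v[of n] by (simp add: n)
    moreover have "k div 2 = n" by (simp add: n)
    ultimately show "D_det k = [: (qnum_m 0 + Q_BB * qnum (int k)) * C_fac k
           * (\<Prod>a<k div 2. qnum (2 * int a + 2) * A_fac k a)
           * (\<Prod>a<k div 2. qnum (2 * int a + 2) * B_fac k a) :]"
      unfolding D_det_eq by (simp only: mult_ac)
  next
    assume "odd k"
    then obtain n where n: "k = 2 * n + 1" by (elim oddE)
    have "(\<Prod>j<Suc k. u_diag k j) = (\<Prod>a<Suc n. qnum (2 * int a + 2) * A_fac k a)"
      using u[of "Suc n"] by (simp add: n)
    \<comment> \<open>For odd \<open>k\<close> the first family splits into \<open>n + 1\<close>
      pairs, while in the second the last index \<open>k\<close> is unpaired and gives
      \<open>[k+1]\<close>.\<close>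
    moreover have "(\<Prod>j<Suc k. v_pivot k j)
        = C_fac k * ((\<Prod>a<n. qnum (2 * int a + 2) * B_fac k a) * qnum (int k + 1))"
    proof -
      have "(\<Prod>j<k. v_pivot k (Suc j)) = (\<Prod>j<2 * n. v_pivot k (Suc j)) * v_pivot k (Suc (2 * n))"
        by (simp add: n)
      moreover have "v_pivot k (Suc (2 * n)) = qnum (int k + 1)"
        by (simp add: v_pivot_def n)
      ultimately show ?thesis by (simp only: v0 v)
    qed
    moreover have "(k + 1) div 2 = Suc n" "(k - 1) div 2 = n" by (simp_all add: n)
    ultimately show "D_det k = [: qnum (int k + 1) * C_fac k
           * (\<Prod>a<(k + 1) div 2. qnum (2 * int a + 2) * A_fac k a)
           * (\<Prod>a<(k - 1) div 2. qnum (2 * int a + 2) * B_fac k a) :]"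
      unfolding D_det_eq by (simp only: mult_ac)
  qed
qed

end
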